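(* Let $n,N\ge 1$ be integers, let $A$ and $B_1,\dots,B_N$ be real symmetric $n\times n$ matrices, let $c_j\in\mathbb{R}$ and $\gamma_j>0$ for $j\in\{1,\dots,N\}$, and let $f\in\mathbb{R}^n$. Define $J:\mathbb{R}^n\to\mathbb{R}$ by $$J(x)=\frac{x^TAx}{2}+\sum_{j=1}^N\frac{\gamma_j}{2}\left(\frac{x^TB_jx}{2}+c_j\right)^2+f^Tx,$$ and assume that $J(x)\to+\infty$ as $|x|\to\infty$. Let $K>0$ be such that $KI_d>A$. Let $x_0\in\mathbb{R}^n$ satisfy $\delta J(x_0)=\mathbf{0}$. Let the functions $J^*$, $\tilde J^*$, the sets $C^*$, $A^*$, the vectors $\hat v_0^*\in\mathbb{R}^N$, $\hat v^*\in\mathbb{R}^n$ and the $n\times n$ matrix $\alpha_1$ be defined from these data as in the context. Then: 1. If $\delta^2J(x_0)>\mathbf{0}$, $\delta^2J(x_0)+(KI_d-A)\alpha_1>\mathbf{0}$ and $\hat v_0^*\in C^*$, then $$\delta\tilde J^*(\hat v^* )=\mathbf{0}\quad\text{and}\quad \delta^2\tilde J^*(\hat v^* )>\mathbf{0},$$ and there exist $r>0$ and $r_1>0$ such that $$J(x_0)=\inf_{x\in B_r(x_0)}J(x)=\inf_{v^*\in B_{r_1}(\hat v^* )}\tilde J^*(v^* )=\tilde J^*(\hat v^* )=\inf_{v^*\in B_{r_1}(\hat v^* )}\ \sup_{v_0^*\in C^*}J^*(v^*,v_0^* )=J^*(\hat v^*,\hat v_0^* ).$$ 2. If $\hat v_0^*\in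 A^*$, then $\delta^2J(x_0)>\mathbf{0}$ and, defining $$J_2^*(v^* )=\sup_{v_0^*\in A^*}J^*(v^*,v_0^* ),\qquad v^*\in\mathbb{R}^n,$$ one has $$\delta J_2^*(\hat v^* )=\mathbf{0},\qquad \delta^2J_2^*(\hat v^* )>\mathbf{0},$$ and $$J(x_0)=\inf_{x\in\mathbb{R}^n}J(x)=\inf_{v^*\in\mathbb{R}^n}J_2^*(v^* )=J_2^*(\hat v^* )=\inf_{v^*\in\mathbb{R}^n}\ \sup_{v_0^*\in A^*}J^*(v^*,v_0^* )=J^*(\hat v^*,\hat v_0^* ).$$ 3. If $\delta^2J(x_0)<\mathbf{0}$, $\delta^2J(x_0)+(KI_d-A)\alpha_1<\mathbf{0}$ and $\hat v_0^*\in C^*$, then $$\delta\tilde J^*(\hat v^* )=\mathbf{0}\quad\text{and}\quad \delta^2\tilde J^*(\hat v^* )<\mathbf{0},$$ and there exist $r>0$ and $r_1>0$ such that $$J(x_0)=\sup_{x\in B_r(x_0)}J(x)=\sup_{v^*\in B_{r_1}(\hat v^* )}\tilde J^*(v^* )=\tilde J^*(\hat v^* )=\sup_{v^*\in B_{r_1}(\hat v^* )}\ \sup_{v_0^*\in C^*}J^*(v^*,v_0^* )=J^*(\hat v^*,\hat v_0^* ).$$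
   Context: Notation. $I_d$ is the $n\times n$ identity matrix; $\delta_{l\eta}$ is the Kronecker delta; $\delta F$ and $\delta^2F$ denote the gradient and the Hessian matrix of a function $F$; $B_r(y)$ is the ball of radius $r$ centered at $y$ (not to be confused with the matrices $B_j$). For an $n\times n$ matrix $M$, $M>\mathbf{0}$ means that $M$ is positive definite, $M<\mathbf{0}$ that $-M>\mathbf{0}$, and $M>M'$ that $M-M'>\mathbf{0}$. Primal decomposition. For $x\in\mathbb{R}^n$, $v\in\mathbb{R}^N$ set $$G_1(x)=-\frac{x^TAx}{2}+\frac K2x^Tx-f^Tx,\qquad G_2(x,v)=\sum_{j=1}^N\frac{\gamma_j}{2}\left(\frac{x^TB_jx}{2}+c_j+v_j\right)^2+\frac K2x^Tx,$$ so that $J(x)=-G_1(x)+G_2(x,\mathbf{0})$. Dual sets. $$C^*=\Big\{v_0^*\in\mathbb{R}^N:\ \sum_{j=1}^N(v_0^* )_jB_j+KI_d>\mathbf{0}\Big\},\quad B^*=\Big\{v_0^*\in\mathbb{R}^N:\ A+\sum_{j=1}^N(v_0^* )_jB_j>\mathbf{0}\Big\},\quad A^*=B^*\cap C^*.$$ Dual functions. $G_1^*:\mathbb{R}^n\to\mathbb{R}$ is $$G_1^*(v^* )=\sup_{x\in\mathbb{R}^n}\{(v^* )^Tx-G_1(x)\}=\tfrac12(v^*+f)^T(KI_d-A)^{-1}(v^*+f),$$ and $G_2^*:\mathbb{R}^n\times C^*\to\mathbb{R}$ is $$G_2^*(v^*,v_0^* )=\sup_{(x,v)\in\mathbb{R}^n\times\mathbb{R}^N}\{(v^*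 )^Tx+(v_0^* )^Tv-G_2(x,v)\}=\tfrac12(v^* )^T\Big(\sum_{j=1}^N(v_0^* )_jB_j+KI_d\Big)^{-1}v^*+\sum_{j=1}^N\frac{(v_0^* )_j^2}{2\gamma_j}-\sum_{j=1}^Nc_j(v_0^* )_j.$$ Set $$J^*(v^*,v_0^* )=G_1^*(v^* )-G_2^*(v^*,v_0^* ),\qquad \tilde J^*(v^* )=\sup_{v_0^*\in C^*}J^*(v^*,v_0^* ).$$ Objects attached to the critical point $x_0$. $$(\hat v_0^* )_j=\gamma_j\left(\frac{x_0^TB_jx_0}{2}+c_j\right)\ (1\le j\le N),\qquad \hat v^*=\sum_{j=1}^N(\hat v_0^* )_jB_jx_0+Kx_0.$$ Write $M=\sum_{p=1}^N(\hat v_0^* )_pB_p+KI_d$ (invertible when $\hat v_0^*\in C^*$). Let $P_1$ be the $n\times N$ matrix with columns $B_1x_0,\dots,B_Nx_0$; let $P_2$ be the $N\times n$ matrix whose $l$-th row is $x_0^TB_lM^{-1}$; let $E$ be the $N\times N$ matrix with entries $$E_{l\eta}=\gamma_l\,x_0^TB_lM^{-1}B_\eta x_0+\delta_{l\eta},$$ and $\overline E=E^{-1}$. Put $$H_3=P_1\,\overline E\,P_2,\qquad \hat B_{jk}=\sum_{l=1}^N\sum_{s,q=1}^n\gamma_l\,(x_0)_s(B_l)_{js}(B_l)_{qk}(x_0)_q\ (1\le j,k\le n),\qquad D=\hat BM^{-1}+I_d,$$ $$\alpha=(I_d-H_3)D-I_d,\qquad \alpha_1=-M^{-1}\,\alpha\,M.$$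 *)

theory Defs
  imports "HOL-Analysis.Analysis"
begin

section \<open>Gradient, Hessian, definiteness\<close>

definition gradient :: "(real^'n \<Rightarrow> real) \<Rightarrow> real^'n \<Rightarrow> real^'n" where
  "gradient F x = (THE D. GDERIV F x :> D)"

definition hessian :: "(real^'n \<Rightarrow> real) \<Rightarrow> real^'n \<Rightarrow> real^'n^'n" where
  "hessian F x = matrix (frechet_derivative (gradient F) (at x))"

text \<open>\<^const>\<open>gradient\<close> and \<^const>\<open>hessian\<close> are only meaningful where the derivatives exist;
  for the Hessian at \<open>x\<close> this is the following condition.\<close>

definition twice_differentiable_at :: "(real^'n \<Rightarrow> real) \<Rightarrow> real^'n \<Rightarrow> bool" where
  "twice_differentiable_at F x \<longleftrightarrow>
     (\<forall>\<^sub>F y in nhds x. F differentiable (at y)) \<and> gradient F differentiable (at x)"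

text \<open>Symmetry is deliberately not part of definiteness: the matrix
  \<open>hessian J x0 + (K I - A) \<alpha>\<^sub>1\<close> to which the notion is applied below need not be symmetric.\<close>

definition pos_def :: "real^'n^'n \<Rightarrow> bool" where
  "pos_def M \<longleftrightarrow> (\<forall>x. x \<noteq> 0 \<longrightarrow> 0 < x \<bullet> (M *v x))"

definition neg_def :: "real^'n^'n \<Rightarrow> bool" where
  "neg_def M \<longleftrightarrow> pos_def (- M)"

section \<open>Primal functions\<close>

definition J_fun :: "real^'n^'n \<Rightarrow> ('m::finite \<Rightarrow> real^'n^'n) \<Rightarrow> real^'m \<Rightarrow> real^'m \<Rightarrow> real^'n
    \<Rightarrow> real^'n \<Rightarrow> real" where
  "J_fun A B c \<gamma> f x =
     x \<bullet> (A *v x) / 2 + (\<Sum>j\<in>UNIV. \<gamma>$j / 2 * (x \<bullet> (B j *v x) / 2 + c$j)\<^sup>2) + f \<bullet> x"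

definition G1 :: "real^'n^'n \<Rightarrow> real^'n \<Rightarrow> real \<Rightarrow> real^'n \<Rightarrow> real" where
  "G1 A f K x = - (x \<bullet> (A *v x) / 2) + K / 2 * (x \<bullet> x) - f \<bullet> x"

definition G2 :: "('m::finite \<Rightarrow> real^'n^'n) \<Rightarrow> real^'m \<Rightarrow> real^'m \<Rightarrow> real
    \<Rightarrow> real^'n \<Rightarrow> real^'m \<Rightarrow> real" where
  "G2 B c \<gamma> K x v =
     (\<Sum>j\<in>UNIV. \<gamma>$j / 2 * (x \<bullet> (B j *v x) / 2 + c$j + v$j)\<^sup>2) + K / 2 * (x \<bullet> x)"

section \<open>Dual sets and functions\<close>

definition M_mat :: "('m::finite \<Rightarrow> real^'n^'n) \<Rightarrow> real \<Rightarrow> real^'m \<Rightarrow> real^'n^'n" where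
  "M_mat B K v0 = (\<Sum>j\<in>UNIV. v0$j *\<^sub>R B j) + mat K"

definition C_star :: "('m::finite \<Rightarrow> real^'n^'n) \<Rightarrow> real \<Rightarrow> (real^'m) set" where
  "C_star B K = {v0. pos_def (M_mat B K v0)}"

definition B_star :: "real^'n^'n \<Rightarrow> ('m::finite \<Rightarrow> real^'n^'n) \<Rightarrow> (real^'m) set" where
  "B_star A B = {v0. pos_def (A + (\<Sum>j\<in>UNIV. v0$j *\<^sub>R B j))}"

definition A_star :: "real^'n^'n \<Rightarrow> ('m::finite \<Rightarrow> real^'n^'n) \<Rightarrow> real \<Rightarrow> (real^'m) set" where
  "A_star A B K = B_star A B \<inter> C_star B K"

definition G1_star :: "real^'n^'n \<Rightarrow> real^'n \<Rightarrow> real \<Rightarrow> real^'n \<Rightarrow> real" where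
  "G1_star A f K v = (SUP x. v \<bullet> x - G1 A f K x)"

definition G2_star :: "('m::finite \<Rightarrow> real^'n^'n) \<Rightarrow> real^'m \<Rightarrow> real^'m \<Rightarrow> real
    \<Rightarrow> real^'n \<Rightarrow> real^'m \<Rightarrow> real" where
  "G2_star B c \<gamma> K v v0 = (SUP (x, w). v \<bullet> x + v0 \<bullet> w - G2 B c \<gamma> K x w)"

definition J_star :: "real^'n^'n \<Rightarrow> ('m::finite \<Rightarrow> real^'n^'n) \<Rightarrow> real^'m \<Rightarrow> real^'m \<Rightarrow> real^'n \<Rightarrow> real
    \<Rightarrow> real^'n \<Rightarrow> real^'m \<Rightarrow> real" where
  "J_star A B c \<gamma> f K v v0 = G1_star A f K v - G2_star B c \<gamma> K v v0"

definition J_tilde :: "real^'n^'n \<Rightarrow> ('m::finite \<Rightarrow> real^'n^'n) \<Rightarrow> real^'m \<Rightarrow> real^'m \<Rightarrow> real^'n \<Rightarrow> real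
    \<Rightarrow> real^'n \<Rightarrow> real" where
  "J_tilde A B c \<gamma> f K v = (SUP v0\<in>C_star B K. J_star A B c \<gamma> f K v v0)"

definition J2_star :: "real^'n^'n \<Rightarrow> ('m::finite \<Rightarrow> real^'n^'n) \<Rightarrow> real^'m \<Rightarrow> real^'m \<Rightarrow> real^'n \<Rightarrow> real
    \<Rightarrow> real^'n \<Rightarrow> real" where
  "J2_star A B c \<gamma> f K v = (SUP v0\<in>A_star A B K. J_star A B c \<gamma> f K v v0)"

section \<open>Objects attached to the critical point\<close>

definition v0_hat :: "('m::finite \<Rightarrow> real^'n^'n) \<Rightarrow> real^'m \<Rightarrow> real^'m \<Rightarrow> real^'n \<Rightarrow> real^'m" where
  "v0_hat B c \<gamma> x0 = (\<chi> j. \<gamma>$j * (x0 \<bullet> (B j *v x0) / 2 + c$j))"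

definition v_hat :: "('m::finite \<Rightarrow> real^'n^'n) \<Rightarrow> real^'m \<Rightarrow> real^'m \<Rightarrow> real \<Rightarrow> real^'n \<Rightarrow> real^'n" where
  "v_hat B c \<gamma> K x0 = (\<Sum>j\<in>UNIV. v0_hat B c \<gamma> x0 $ j *\<^sub>R (B j *v x0)) + K *\<^sub>R x0"

definition M_hat :: "('m::finite \<Rightarrow> real^'n^'n) \<Rightarrow> real^'m \<Rightarrow> real^'m \<Rightarrow> real \<Rightarrow> real^'n
    \<Rightarrow> real^'n^'n" where
  "M_hat B c \<gamma> K x0 = M_mat B K (v0_hat B c \<gamma> x0)"

definition P1 :: "('m::finite \<Rightarrow> real^'n^'n) \<Rightarrow> real^'n \<Rightarrow> real^'m^'n" where
  "P1 B x0 = (\<chi> i j. (B j *v x0) $ i)"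

definition P2 :: "('m::finite \<Rightarrow> real^'n^'n) \<Rightarrow> real^'m \<Rightarrow> real^'m \<Rightarrow> real \<Rightarrow> real^'n
    \<Rightarrow> real^'n^'m" where
  "P2 B c \<gamma> K x0 = (\<chi> l. x0 v* (B l ** matrix_inv (M_hat B c \<gamma> K x0)))"

definition E_mat :: "('m::finite \<Rightarrow> real^'n^'n) \<Rightarrow> real^'m \<Rightarrow> real^'m \<Rightarrow> real \<Rightarrow> real^'n
    \<Rightarrow> real^'m^'m" where
  "E_mat B c \<gamma> K x0 = (\<chi> l \<eta>.
     \<gamma>$l * (x0 \<bullet> ((B l ** matrix_inv (M_hat B c \<gamma> K x0) ** B \<eta>) *v x0))
     + (if l = \<eta> then 1 else 0))"

definition H3 :: "('m::finite \<Rightarrow> real^'n^'n) \<Rightarrow> real^'m \<Rightarrow> real^'m \<Rightarrow> real \<Rightarrow> real^'n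
    \<Rightarrow> real^'n^'n" where
  "H3 B c \<gamma> K x0 = P1 B x0 ** matrix_inv (E_mat B c \<gamma> K x0) ** P2 B c \<gamma> K x0"

definition B_hat :: "('m::finite \<Rightarrow> real^'n^'n) \<Rightarrow> real^'m \<Rightarrow> real^'n \<Rightarrow> real^'n^'n" where
  "B_hat B \<gamma> x0 = (\<chi> j k. \<Sum>l\<in>UNIV. \<Sum>s\<in>UNIV. \<Sum>q\<in>UNIV.
     \<gamma>$l * x0$s * B l$j$s * B l$q$k * x0$q)"

definition D_mat :: "('m::finite \<Rightarrow> real^'n^'n) \<Rightarrow> real^'m \<Rightarrow> real^'m \<Rightarrow> real \<Rightarrow> real^'n
    \<Rightarrow> real^'n^'n" where
  "D_mat B c \<gamma> K x0 = B_hat B \<gamma> x0 ** matrix_inv (M_hat B c \<gamma> K x0) + mat 1"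

definition alpha :: "('m::finite \<Rightarrow> real^'n^'n) \<Rightarrow> real^'m \<Rightarrow> real^'m \<Rightarrow> real \<Rightarrow> real^'n
    \<Rightarrow> real^'n^'n" where
  "alpha B c \<gamma> K x0 = (mat 1 - H3 B c \<gamma> K x0) ** D_mat B c \<gamma> K x0 - mat 1"

definition alpha1 :: "('m::finite \<Rightarrow> real^'n^'n) \<Rightarrow> real^'m \<Rightarrow> real^'m \<Rightarrow> real \<Rightarrow> real^'n
    \<Rightarrow> real^'n^'n" where
  "alpha1 B c \<gamma> K x0 =
     - (matrix_inv (M_hat B c \<gamma> K x0) ** alpha B c \<gamma> K x0 ** M_hat B c \<gamma> K x0)"

section \<open>The suprema above are finite\<close>

text \<open>Suprema of sets of reals carry information only for nonempty sets that are bounded above.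
  The lemmas below check this for the suprema in the definitions (\<^const>\<open>A_star\<close> may be empty,
  but \<^const>\<open>J2_star\<close> is only considered when it contains \<^const>\<open>v0_hat\<close>), and give the
  closed forms of \<^const>\<open>G1_star\<close> and \<^const>\<open>G2_star\<close>.\<close>

lemma pos_def_invertible:
  fixes Q :: "real^'n^'n"
  assumes "pos_def Q"
  shows "invertible Q"
proof -
  have "\<forall>x. Q *v x = 0 \<longrightarrow> x = 0"
    using assms unfolding pos_def_def by (metis inner_zero_right less_irrefl)
  then show ?thesis
    by (simp add: invertible_left_inverse matrix_left_invertible_ker)
qed

lemma pos_def_ge_0: "pos_def Q \<Longrightarrow> 0 \<le> x \<bullet> (Q *v x)"
  unfolding pos_def_def by (cases "x = 0") (auto intro: less_imp_le)

lemma matrix_inv_mult_vec: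
  fixes Q :: "real^'n^'n"
  assumes "pos_def Q"
  shows "Q *v (matrix_inv Q *v w) = w"
  using someI_ex[OF pos_def_invertible[OF assms, unfolded invertible_def]]
  by (simp add: matrix_inv_def matrix_vector_mul_assoc)

lemma matrix_inv_form_ge_0:
  fixes Q :: "real^'n^'n"
  assumes "pos_def Q"
  shows "0 \<le> w \<bullet> (matrix_inv Q *v w)"
  using pos_def_ge_0[OF assms, of "matrix_inv Q *v w"] matrix_inv_mult_vec[OF assms, of w]
  by (simp add: inner_commute)

lemma quadratic_form_le:
  fixes Q :: "real^'n^'n"
  assumes Q: "pos_def Q" "transpose Q = Q"
  shows "w \<bullet> x - x \<bullet> (Q *v x) / 2 \<le> w \<bullet> (matrix_inv Q *v w) / 2"
proof -
  define y where "y = matrix_inv Q *v w"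
  have Qy: "Q *v y = w" unfolding y_def by (rule matrix_inv_mult_vec[OF Q(1)])
  have "y \<bullet> (Q *v x) = w \<bullet> x"
    using dot_lmul_matrix[of y Q x] Q(2) Qy by (metis transpose_matrix_vector)
  moreover have "0 \<le> (x - y) \<bullet> (Q *v (x - y))" by (rule pos_def_ge_0[OF Q(1)])
  ultimately show ?thesis
    unfolding y_def[symmetric]
    by (simp add: matrix_vector_mult_diff_distrib inner_diff_left inner_diff_right Qy inner_commute)
qed

lemma mat_mult_vec: "(mat k :: real^'n^'n) *v x = k *\<^sub>R x"
proof -
  have "(mat k :: real^'n^'n) = k *\<^sub>R mat 1"
    by (simp add: mat_def vec_eq_iff)
  then show ?thesis by (simp add: scaleR_matrix_vector_assoc[symmetric])
qed

lemma transpose_M_mat: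
  assumes "\<And>j. transpose (B j) = B j"
  shows "transpose (M_mat B K v0) = M_mat B K v0"
proof -
  have "B l $ i $ k = B l $ k $ i" for l i k
    using arg_cong[OF assms[of l], of "\<lambda>X. X $ k $ i"] by (simp add: transpose_def)
  then show ?thesis
    by (simp add: M_mat_def transpose_def vec_eq_iff mat_def)
qed

lemma M_mat_form:
  "x \<bullet> (M_mat B K v0 *v x) = (\<Sum>j\<in>UNIV. v0$j * (x \<bullet> (B j *v x))) + K * (x \<bullet> x)"
proof -
  have "(\<Sum>j\<in>S. v0$j *\<^sub>R B j) *v x = (\<Sum>j\<in>S. v0$j *\<^sub>R (B j *v x))" for S
    by (induction S rule: infinite_finite_induct)
      (auto simp: matrix_vector_mult_add_rdistrib scaleR_matrix_vector_assoc[symmetric])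
  then show ?thesis
    by (simp add: M_mat_def matrix_vector_mult_add_rdistrib mat_mult_vec inner_add_right
        inner_sum_right)
qed

lemma G1_star_form:
  assumes "transpose A = A" "pos_def (mat K - A)"
  shows "G1_star A f K v = (v + f) \<bullet> (matrix_inv (mat K - A) *v (v + f)) / 2"
    and "bdd_above (range (\<lambda>x. v \<bullet> x - G1 A f K x))"
proof -
  let ?Q = "mat K - A" and ?w = "v + f"
  have sym: "transpose ?Q = ?Q"
    using assms(1) by (simp add: transpose_def vec_eq_iff mat_def)
  have eq: "v \<bullet> x - G1 A f K x = ?w \<bullet> x - x \<bullet> (?Q *v x) / 2" for x
    by (simp add: G1_def matrix_vector_mult_diff_rdistrib mat_mult_vec inner_diff_right
        inner_add_left field_simps)
  have le: "v \<bullet> x - G1 A f K x \<le> ?w \<bullet> (matrix_inv ?Q *v ?w) / 2" for x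
    unfolding eq by (rule quadratic_form_le[OF assms(2) sym])
  then show "bdd_above (range (\<lambda>x. v \<bullet> x - G1 A f K x))"
    by (intro bdd_aboveI[where M = "?w \<bullet> (matrix_inv ?Q *v ?w) / 2"]) blast
  have "?w \<bullet> (matrix_inv ?Q *v ?w) / 2 =
      v \<bullet> (matrix_inv ?Q *v ?w) - G1 A f K (matrix_inv ?Q *v ?w)"
    unfolding eq matrix_inv_mult_vec[OF assms(2)] by (simp add: inner_commute)
  then have "?w \<bullet> (matrix_inv ?Q *v ?w) / 2 \<in> range (\<lambda>x. v \<bullet> x - G1 A f K x)" by blast
  then show "G1_star A f K v = ?w \<bullet> (matrix_inv ?Q *v ?w) / 2"
    unfolding G1_star_def using le by (intro cSup_eq_maximum) auto
qed

lemma G2_star_form: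
  fixes B :: "'m::finite \<Rightarrow> real^'n^'n"
  assumes "\<And>j. transpose (B j) = B j" "\<And>j. 0 < \<gamma>$j" "v0 \<in> C_star B K"
  shows "G2_star B c \<gamma> K v v0 = v \<bullet> (matrix_inv (M_mat B K v0) *v v) / 2
      + (\<Sum>j\<in>UNIV. (v0$j)\<^sup>2 / (2 * \<gamma>$j)) - (\<Sum>j\<in>UNIV. c$j * v0$j)" (is "_ = ?R")
    and "bdd_above (range (\<lambda>(x, w). v \<bullet> x + v0 \<bullet> w - G2 B c \<gamma> K x w))"
proof -
  let ?Q = "M_mat B K v0"
  have Q: "pos_def ?Q" using assms(3) by (simp add: C_star_def)
  define u where "u x w j = x \<bullet> (B j *v x) / 2 + c$j + w$j" for x and w :: "real^'m" and j
  have eq: "v \<bullet> x + v0 \<bullet> w - G2 B c \<gamma> K x w =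
      (v \<bullet> x - x \<bullet> (?Q *v x) / 2)
      + (\<Sum>j\<in>UNIV. (v0$j)\<^sup>2 / (2 * \<gamma>$j)) - (\<Sum>j\<in>UNIV. c$j * v0$j)
      - (\<Sum>j\<in>UNIV. \<gamma>$j / 2 * (u x w j - v0$j / \<gamma>$j)\<^sup>2)" for x w
  proof -
    have t: "v0$j * w$j - \<gamma>$j / 2 * (u x w j)\<^sup>2 =
        - (v0$j * (x \<bullet> (B j *v x)) / 2) + (v0$j)\<^sup>2 / (2 * \<gamma>$j) - c$j * v0$j
        - \<gamma>$j / 2 * (u x w j - v0$j / \<gamma>$j)\<^sup>2" for j
    proof -
      have w: "w$j = u x w j - x \<bullet> (B j *v x) / 2 - c$j" by (simp add: u_def)
      show ?thesis
        unfolding w using assms(2)[of j] by (simp add: field_simps power2_eq_square)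
    qed
    have "v0 \<bullet> w - (\<Sum>j\<in>UNIV. \<gamma>$j / 2 * (u x w j)\<^sup>2) =
        (\<Sum>j\<in>UNIV. v0$j * w$j - \<gamma>$j / 2 * (u x w j)\<^sup>2)"
      by (simp add: inner_vec_def sum_subtractf)
    also have "\<dots> = - (\<Sum>j\<in>UNIV. v0$j * (x \<bullet> (B j *v x))) / 2
        + (\<Sum>j\<in>UNIV. (v0$j)\<^sup>2 / (2 * \<gamma>$j)) - (\<Sum>j\<in>UNIV. c$j * v0$j)
        - (\<Sum>j\<in>UNIV. \<gamma>$j / 2 * (u x w j - v0$j / \<gamma>$j)\<^sup>2)"
      unfolding t by (simp add: sum_subtractf sum.distrib sum_negf sum_divide_distrib)
    finally show ?thesis
      unfolding M_mat_form G2_def u_def by (simp add: field_simps)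
  qed
  have nn: "0 \<le> (\<Sum>j\<in>UNIV. \<gamma>$j / 2 * (u x w j - v0$j / \<gamma>$j)\<^sup>2)" for x w
    using assms(2) by (intro sum_nonneg mult_nonneg_nonneg) (auto intro: less_imp_le)
  have le: "v \<bullet> x + v0 \<bullet> w - G2 B c \<gamma> K x w \<le> ?R" for x w
    unfolding eq
    using quadratic_form_le[OF Q transpose_M_mat[of B, OF assms(1)], of v x] nn[of x w]
    by linarith
  then show "bdd_above (range (\<lambda>(x, w). v \<bullet> x + v0 \<bullet> w - G2 B c \<gamma> K x w))"
    by (intro bdd_aboveI[where M = ?R]) (clarify, blast)
  let ?x = "matrix_inv ?Q *v v"
  let ?w = "\<chi> j. v0$j / \<gamma>$j - ?x \<bullet> (B j *v ?x) / 2 - c$j"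
  have "?R = v \<bullet> ?x + v0 \<bullet> ?w - G2 B c \<gamma> K ?x ?w"
    unfolding eq matrix_inv_mult_vec[OF Q] by (simp add: u_def inner_commute)
  then have "?R \<in> range (\<lambda>(x, w). v \<bullet> x + v0 \<bullet> w - G2 B c \<gamma> K x w)"
    by (intro image_eqI[where x = "(?x, ?w)"]) auto
  then show "G2_star B c \<gamma> K v v0 = ?R"
    unfolding G2_star_def using le by (intro cSup_eq_maximum) auto
qed

lemma C_star_nonempty: "0 < K \<Longrightarrow> C_star B K \<noteq> {}"
  by (auto simp: C_star_def pos_def_def M_mat_form zero_less_mult_iff intro!: exI[of _ 0])

lemma bdd_above_J_star:
  assumes "\<And>j. transpose (B j) = B j" "\<And>j. 0 < \<gamma>$j"
  shows "bdd_above (J_star A B c \<gamma> f K v ` C_star B K)"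
    and "bdd_above (J_star A B c \<gamma> f K v ` A_star A B K)"
proof -
  have "J_star A B c \<gamma> f K v v0 \<le> G1_star A f K v + (\<Sum>j\<in>UNIV. \<gamma>$j * (c$j)\<^sup>2 / 2)"
    if v0: "v0 \<in> C_star B K" for v0
  proof -
    have "c$j * v0$j - (v0$j)\<^sup>2 / (2 * \<gamma>$j) \<le> \<gamma>$j * (c$j)\<^sup>2 / 2" for j
    proof -
      have "\<gamma>$j * (c$j)\<^sup>2 / 2 - (c$j * v0$j - (v0$j)\<^sup>2 / (2 * \<gamma>$j))
          = (\<gamma>$j * c$j - v0$j)\<^sup>2 / (2 * \<gamma>$j)"
        using assms(2)[of j] by (simp add: field_simps power2_eq_square)
      also have "\<dots> \<ge> 0" using assms(2)[of j] by simp
      finally show ?thesis by simp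
    qed
    then have "(\<Sum>j\<in>UNIV. c$j * v0$j - (v0$j)\<^sup>2 / (2 * \<gamma>$j)) \<le> (\<Sum>j\<in>UNIV. \<gamma>$j * (c$j)\<^sup>2 / 2)"
      by (rule sum_mono)
    moreover have "0 \<le> v \<bullet> (matrix_inv (M_mat B K v0) *v v)"
      using v0 by (intro matrix_inv_form_ge_0) (simp add: C_star_def)
    ultimately show ?thesis
      unfolding J_star_def G2_star_form[of B \<gamma> v0 K, OF assms v0] by (simp add: sum_subtractf)
  qed
  then show "bdd_above (J_star A B c \<gamma> f K v ` C_star B K)"
    by (intro bdd_aboveI[where M = "G1_star A f K v + (\<Sum>j\<in>UNIV. \<gamma>$j * (c$j)\<^sup>2 / 2)"]) blast
  then show "bdd_above (J_star A B c \<gamma> f K v ` A_star A B K)"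
    by (rule bdd_above_mono) (auto simp: A_star_def)
qed

end

theory Submission
  imports Defs
begin

text \<open>
  Put \<open>\<Psi>(x) = G2(x, 0)\<close>, so that \<open>J = \<Psi> - G1\<close>. The maps \<open>v0_hat\<close> and \<open>v_hat\<close> make sense at
  every \<open>x\<close>, and \<open>v_hat\<close> is the gradient of \<open>\<Psi>\<close>. Whenever \<open>v0_hat x\<close> lies in \<open>C\<^sup>*\<close>, it minimises
  \<open>G2\<^sup>*(v_hat x, \<cdot>)\<close> over \<open>C\<^sup>*\<close>, and the minimum is \<open>v_hat x \<bullet> x - \<Psi>(x)\<close>. Near \<open>v_hat x0\<close> the
  dual function is therefore \<open>G1\<^sup>*\<close> minus the Legendre transform of \<open>\<Psi>\<close>. With \<open>Q = K I - A\<close> and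
  \<open>H\<close> the Hessian of \<open>\<Psi>\<close> at \<open>x0\<close>, the primal Hessian is \<open>H - Q\<close> and the dual one is
  \<open>Q\<^sup>-\<^sup>1 - H\<^sup>-\<^sup>1\<close>; both \<open>Q\<close> and \<open>H\<close> are positive definite, and inversion reverses the order of
  positive definite matrices, so the two Hessians have the same sign. On \<open>A\<^sup>*\<close> the minimum is global
  because \<open>J(y) \<ge> J\<^sup>*(Q y - f, u)\<close> for every \<open>u\<close> in \<open>C\<^sup>*\<close>, and \<open>J\<^sup>*(\<cdot>, u)\<close> is convex for
  \<open>u\<close> in \<open>A\<^sup>*\<close>.
\<close>

section \<open>Gradients and Hessians\<close>

lemma gradient_eqI:
  assumes "GDERIV F x :> D"
  shows "gradient F x = D"
  unfolding gradient_def
proof (rule the_equality)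
  fix D' assume "GDERIV F x :> D'"
  then have "(\<lambda>h. h \<bullet> D') = (\<lambda>h. h \<bullet> D)"
    using assms unfolding gderiv_def by (rule has_derivative_unique)
  then show "D' = D"
    by (metis vector_eq_ldot)
qed (rule assms)

text \<open>\<open>gradient F\<close> agrees with \<open>G\<close> on a neighbourhood of
  \<open>x\<close>, which is all that a derivative at \<open>x\<close> depends on.\<close>

lemma gradient_has_derivative:
  assumes "\<forall>\<^sub>F y in nhds x. GDERIV F y :> G y" and "(G has_derivative (*v) H) (at x)"
  shows "(gradient F has_derivative (*v) H) (at x)"
proof -
  obtain S where S: "open S" "x \<in> S" "\<And>y. y \<in> S \<Longrightarrow> GDERIV F y :> G y"
    using assms(1) unfolding eventually_nhds by blast
  show ?thesis
    by (rule has_derivative_transform_within_open[OF assms(2) S(1,2)])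
      (use S(3) gradient_eqI in metis)
qed

lemma twice_differentiable_atI:
  assumes "\<forall>\<^sub>F y in nhds x. GDERIV F y :> G y" and "(G has_derivative (*v) H) (at x)"
  shows "twice_differentiable_at F x"
  unfolding twice_differentiable_at_def
proof
  show "\<forall>\<^sub>F y in nhds x. F differentiable (at y)"
    using assms(1) by eventually_elim (auto simp: gderiv_def differentiable_def)
  show "gradient F differentiable (at x)"
    using gradient_has_derivative[OF assms] by (auto simp: differentiable_def)
qed

lemma hessian_eqI:
  assumes "\<forall>\<^sub>F y in nhds x. GDERIV F y :> G y" and "(G has_derivative (*v) H) (at x)"
  shows "hessian F x = H"
  unfolding hessian_def frechet_derivative_at[OF gradient_has_derivative[OF assms], symmetric]
  by simp

section \<open>Definite matrices\<close>

lemma inner_symmetric_matrix: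
  fixes S :: "real^'n^'n"
  assumes "transpose S = S"
  shows "x \<bullet> (S *v y) = y \<bullet> (S *v x)"
  by (metis assms dot_lmul_matrix inner_commute transpose_matrix_vector)

text \<open>The form is homogeneous of degree two, so its sign is decided on the unit sphere;
  compactness of the sphere is what the next two results exploit.\<close>

lemma pos_def_iff_sphere:
  "pos_def Q \<longleftrightarrow> (\<forall>x\<in>sphere 0 1. 0 < x \<bullet> (Q *v x))"
proof
  assume *: "\<forall>x\<in>sphere 0 1. 0 < x \<bullet> (Q *v x)"
  show "pos_def Q"
    unfolding pos_def_def
  proof (intro allI impI)
    fix x :: "real^'a" assume "x \<noteq> 0"
    then have "x /\<^sub>R norm x \<in> sphere 0 1"
      by simp
    with * have "0 < (x /\<^sub>R norm x) \<bullet> (Q *v (x /\<^sub>R norm x))"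
      by (rule bspec)
    then have "0 < (inverse (norm x) * inverse (norm x)) * (x \<bullet> (Q *v x))"
      by (simp add: matrix_vector_mult_scaleR mult.assoc)
    with \<open>x \<noteq> 0\<close> show "0 < x \<bullet> (Q *v x)"
      by (simp add: zero_less_mult_iff)
  qed
qed (metis mem_sphere_0 norm_zero pos_def_def zero_neq_one)

text \<open>The constant is the minimum of the form on the unit sphere, attained by
  compactness.\<close>

lemma pos_def_lower_bound:
  fixes Q :: "real^'n^'n"
  assumes "pos_def Q"
  obtains l where "l > 0" "\<And>x. l * (norm x)\<^sup>2 \<le> x \<bullet> (Q *v x)"
proof -
  have "sphere (0 :: real^'n) 1 \<noteq> {}"
    using vector_choose_size[of 1] by (metis empty_iff mem_sphere_0 zero_le_one)
  moreover have "continuous_on (sphere 0 1) (\<lambda>x. x \<bullet> (Q *v x))"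
    by (intro continuous_intros)
  ultimately obtain u where u: "u \<in> sphere 0 1"
    and min: "\<And>x. x \<in> sphere 0 1 \<Longrightarrow> u \<bullet> (Q *v u) \<le> x \<bullet> (Q *v x)"
    using continuous_attains_inf[OF compact_sphere, of 0 1 "\<lambda>x. x \<bullet> (Q *v x)"] by blast
  have "u \<bullet> (Q *v u) * (norm x)\<^sup>2 \<le> x \<bullet> (Q *v x)" for x
  proof (cases "x = 0")
    case False
    then have "u \<bullet> (Q *v u) \<le> (x /\<^sub>R norm x) \<bullet> (Q *v (x /\<^sub>R norm x))"
      by (intro min) simp
    also have "\<dots> = (x \<bullet> (Q *v x)) / (norm x)\<^sup>2"
      by (simp add: matrix_vector_mult_scaleR power2_eq_square divide_inverse)
    finally show ?thesis
      using False by (simp add: field_simps)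
  qed simp
  moreover have "0 < u \<bullet> (Q *v u)"
    using assms u by (simp add: pos_def_iff_sphere)
  ultimately show thesis
    using that by blast
qed

text \<open>The complement is the projection, along the compact sphere, of a closed set of pairs,
  hence closed.\<close>

lemma open_pos_def: "open {Q :: real^'n^'n. pos_def Q}"
proof -
  \<comment> \<open>Coordinates reduce joint continuity in vector and matrix to sums of
    products.\<close>
  have "continuous_on UNIV (\<lambda>p :: (real^'n) \<times> (real^'n^'n). fst p \<bullet> (snd p *v fst p))"
    unfolding inner_vec_def matrix_vector_mult_def inner_real_def vec_lambda_beta
    by (intro continuous_intros)
  then have "closed {p :: (real^'n) \<times> (real^'n^'n). fst p \<bullet> (snd p *v fst p) \<le> 0}"
    by (intro closed_Collect_le continuous_on_const)
  from closed_compact_projection[OF compact_sphere[of 0 1] this]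
  have "closed {Q :: real^'n^'n. \<exists>x. x \<in> sphere 0 1 \<and> x \<bullet> (Q *v x) \<le> 0}"
    by simp
  also have "{Q :: real^'n^'n. \<exists>x. x \<in> sphere 0 1 \<and> x \<bullet> (Q *v x) \<le> 0} = - {Q. pos_def Q}"
    unfolding pos_def_iff_sphere by (auto simp: not_less simp del: mem_sphere_0 mem_sphere)
  finally show ?thesis
    by (simp add: closed_def)
qed

lemma matrix_inv_mult_vec_left:
  fixes Q :: "real^'n^'n"
  assumes "pos_def Q"
  shows "matrix_inv Q *v (Q *v x) = x"
  using someI_ex[OF pos_def_invertible[OF assms, unfolded invertible_def]]
  by (simp add: matrix_inv_def matrix_vector_mul_assoc)

lemma inner_matrix_inv_symmetric:
  fixes Q :: "real^'n^'n"
  assumes "pos_def Q" "transpose Q = Q"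
  shows "x \<bullet> (matrix_inv Q *v y) = y \<bullet> (matrix_inv Q *v x)"
  using inner_symmetric_matrix[OF assms(2), of "matrix_inv Q *v x" "matrix_inv Q *v y"]
  by (simp add: matrix_inv_mult_vec[OF assms(1)] inner_commute)

text \<open>With \<open>y = matrix_inv R *v v\<close>, the quadratic Fenchel-Young inequality for
  \<open>Q\<close> bounds \<open>v \<bullet> (matrix_inv Q *v v) / 2\<close> below by
  \<open>v \<bullet> y - y \<bullet> (Q *v y) / 2\<close>. This exceeds
  \<open>v \<bullet> y / 2\<close>, because
  \<open>y \<bullet> (Q *v y) < y \<bullet> (R *v y) = v \<bullet> y\<close>.\<close>

lemma pos_def_matrix_inv_diff:
  fixes Q R :: "real^'n^'n"
  assumes Q: "pos_def Q" "transpose Q = Q" and R: "pos_def R" and less: "pos_def (R - Q)"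
  shows "pos_def (matrix_inv Q - matrix_inv R)"
  unfolding pos_def_def
proof (intro allI impI)
  fix v :: "real^'n" assume "v \<noteq> 0"
  define y where "y = matrix_inv R *v v"
  have Ry: "R *v y = v"
    unfolding y_def by (rule matrix_inv_mult_vec[OF R])
  with \<open>v \<noteq> 0\<close> have "y \<noteq> 0"
    by auto
  then have "y \<bullet> (Q *v y) < v \<bullet> y"
    using less by (auto simp: pos_def_def matrix_vector_mult_diff_rdistrib inner_diff_right Ry
        inner_commute)
  with quadratic_form_le[OF Q, of v y] have "v \<bullet> y < v \<bullet> (matrix_inv Q *v v)"
    by linarith
  then show "0 < v \<bullet> ((matrix_inv Q - matrix_inv R) *v v)"
    by (simp add: matrix_vector_mult_diff_rdistrib inner_diff_right y_def)
qed

section \<open>Second-order conditions\<close>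

text \<open>The mean value theorem on the segment from \<open>x\<close> to \<open>y\<close> reduces
  the increment of \<open>F\<close> to \<open>G\<close> at one intermediate point, where
  differentiability of \<open>G\<close> at \<open>x\<close> alone suffices.\<close>

lemma second_order_local_min:
  assumes grad: "\<forall>\<^sub>F y in nhds x. GDERIV F y :> G y" and hess: "(G has_derivative (*v) H) (at x)"
    and "G x = 0" and "pos_def H"
  obtains r where "r > 0" "\<And>y. y \<in> ball x r \<Longrightarrow> F x \<le> F y"
proof -
  obtain l where l: "l > 0" "\<And>z. l * (norm z)\<^sup>2 \<le> z \<bullet> (H *v z)"
    using pos_def_lower_bound[OF \<open>pos_def H\<close>] by blast
  \<comment> \<open>The tolerance is the coercivity constant \<open>l\<close> of \<open>H\<close>,
    so the linearisation error cannot outweigh the quadratic form.\<close>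
  obtain d where d: "d > 0"
    and approx: "\<And>y. norm (y - x) < d \<Longrightarrow> norm (G y - H *v (y - x)) \<le> l * norm (y - x)"
    using hess l(1) \<open>G x = 0\<close> unfolding has_derivative_at_alt by auto
  obtain d' where d': "d' > 0" "\<And>y. dist y x < d' \<Longrightarrow> GDERIV F y :> G y"
    using grad unfolding eventually_nhds_metric by blast
  have "F x \<le> F y" if y: "y \<in> ball x (min d d')" for y
  proof -
    define h where "h = y - x"
    have h: "norm h < d" "norm h < d'"
      using y by (auto simp: h_def dist_norm norm_minus_commute)
    have small: "norm (t *\<^sub>R h) \<le> norm h" if "0 \<le> t" "t \<le> 1" for t
      using that by (simp add: mult_left_le_one_le)
    have "\<exists>t\<in>{0<..<1}. F (x + 1 *\<^sub>R h) - F (x + 0 *\<^sub>R h) = (1 - 0) * (h \<bullet> G (x + t *\<^sub>R h))"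
    proof (rule mvt_simple)
      fix t :: real assume t: "0 \<le> t" "t \<le> 1"
      have "dist (x + t *\<^sub>R h) x < d'"
        using small[OF t] h(2) by (simp add: dist_norm)
      from d'(2)[OF this]
      have "(F has_derivative (\<lambda>k. k \<bullet> G (x + t *\<^sub>R h))) (at (x + t *\<^sub>R h))"
        by (simp add: gderiv_def)
      moreover have "((\<lambda>t. x + t *\<^sub>R h) has_derivative (\<lambda>s. s *\<^sub>R h)) (at t within {0..1})"
        by (auto intro!: derivative_eq_intros)
      ultimately have "((\<lambda>t. F (x + t *\<^sub>R h)) has_derivative (\<lambda>s. (s *\<^sub>R h) \<bullet> G (x + t *\<^sub>R h)))
          (at t within {0..1})"
        by (rule has_derivative_compose[rotated])
      then show "((\<lambda>t. F (x + t *\<^sub>R h)) has_derivative (\<lambda>s. s * (h \<bullet> G (x + t *\<^sub>R h))))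
          (at t within {0..1})"
        by simp
    qed simp
    then obtain t where t: "0 < t" "t < 1" and eq: "F y - F x = h \<bullet> G (x + t *\<^sub>R h)"
      by (auto simp: h_def)
    \<comment> \<open>Rescaling by \<open>t > 0\<close> preserves the sign of the increment and
      places the estimate at the displacement where \<open>G\<close> is evaluated.\<close>
    define k where "k = t *\<^sub>R h"
    have "norm k < d"
      using small[of t] t h(1) by (simp add: k_def)
    then have "norm (G (x + k) - H *v k) \<le> l * norm k"
      using approx[of "x + k"] by simp
    then have "\<bar>k \<bullet> (G (x + k) - H *v k)\<bar> \<le> norm k * (l * norm k)"
      using Cauchy_Schwarz_ineq2[of k "G (x + k) - H *v k"]
      by (meson mult_left_mono norm_ge_zero order_trans)
    then have "0 \<le> k \<bullet> G (x + k)"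
      using l(2)[of k] by (simp add: inner_diff_right power2_eq_square mult_ac)
    with t(1) eq show "F x \<le> F y"
      by (simp add: k_def zero_le_mult_iff)
  qed
  with d d'(1) show thesis
    by (intro that[of "min d d'"]) auto
qed

lemma second_order_local_max:
  assumes grad: "\<forall>\<^sub>F y in nhds x. GDERIV F y :> G y" and hess: "(G has_derivative (*v) H) (at x)"
    and "G x = 0" and "neg_def H"
  obtains r where "r > 0" "\<And>y. y \<in> ball x r \<Longrightarrow> F y \<le> F x"
proof (rule second_order_local_min[where x = x and F = "\<lambda>y. - F y"
      and G = "\<lambda>y. - G y" and H = "- H"])
  show "\<forall>\<^sub>F y in nhds x. GDERIV (\<lambda>y. - F y) y :> - G y"
    using grad by eventually_elim (rule GDERIV_minus)
  have "(*v) (- H) = (\<lambda>h. - (H *v h))"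
    using matrix_vector_mult_diff_rdistrib[of 0 H] by (simp add: fun_eq_iff)
  then show "((\<lambda>y. - G y) has_derivative (*v) (- H)) (at x)"
    using has_derivative_minus[OF hess] by simp
qed (use assms that in \<open>auto simp: neg_def_def\<close>)

text \<open>Extrema in \<open>ereal\<close> exist for every set, so an attained bound alone
  determines the value.\<close>

lemma INF_ereal_eq_min:
  assumes "a \<in> S" "\<And>x. x \<in> S \<Longrightarrow> F a \<le> F x"
  shows "(INF x\<in>S. ereal (F x)) = ereal (F a)"
  using assms by (intro antisym INF_lower INF_greatest) auto

lemma SUP_ereal_eq_max:
  assumes "a \<in> S" "\<And>x. x \<in> S \<Longrightarrow> F x \<le> F a"
  shows "(SUP x\<in>S. ereal (F x)) = ereal (F a)"
  using assms by (intro antisym SUP_upper SUP_least) auto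

section \<open>The primal function and its convex part\<close>

lemma v_hat_eq: "v_hat B c \<gamma> K x = M_hat B c \<gamma> K x *v x"
proof -
  have "(\<Sum>j\<in>S. u$j *\<^sub>R B j) *v x = (\<Sum>j\<in>S. u$j *\<^sub>R (B j *v x))" for S u
    by (induction S rule: infinite_finite_induct)
      (auto simp: matrix_vector_mult_add_rdistrib scaleR_matrix_vector_assoc[symmetric])
  then show ?thesis
    by (simp add: v_hat_def M_hat_def M_mat_def matrix_vector_mult_add_rdistrib mat_mult_vec)
qed

text \<open>\<open>B_hat\<close> is the weighted sum of the rank-one matrices formed from the column
  \<open>B l *v x\<close> and the row \<open>x v* B l\<close>.\<close>

lemma B_hat_mult_vec:
  "B_hat B \<gamma> x *v h = (\<Sum>l\<in>UNIV. (\<gamma>$l * (x \<bullet> (B l *v h))) *\<^sub>R (B l *v x))"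
proof -
  have "(B_hat B \<gamma> x *v h) $ i = (\<Sum>l\<in>UNIV. (\<gamma>$l * (x \<bullet> (B l *v h))) *\<^sub>R (B l *v x)) $ i" for i
  proof -
    have "(B_hat B \<gamma> x *v h) $ i =
        (\<Sum>k\<in>UNIV. \<Sum>l\<in>UNIV. \<Sum>s\<in>UNIV. \<Sum>q\<in>UNIV. \<gamma>$l * x$s * B l$i$s * B l$q$k * x$q * h$k)"
      by (simp add: B_hat_def matrix_vector_mult_def sum_distrib_right)
    also have "\<dots> =
        (\<Sum>l\<in>UNIV. \<Sum>k\<in>UNIV. \<Sum>s\<in>UNIV. \<Sum>q\<in>UNIV. \<gamma>$l * x$s * B l$i$s * B l$q$k * x$q * h$k)"
      by (rule sum.swap)
    also have "\<dots> = (\<Sum>l\<in>UNIV. \<gamma>$l * (x \<bullet> (B l *v h)) * (B l *v x) $ i)"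
    proof (rule sum.cong[OF refl])
      fix l
      \<comment> \<open>In the order \<open>q\<close>, \<open>k\<close>, \<open>s\<close> the sum
        over \<open>s\<close> splits off as \<open>(B l *v x) $ i\<close>, and the rest is
        \<open>x \<bullet> (B l *v h)\<close>.\<close>
      have "(\<Sum>k\<in>UNIV. \<Sum>s\<in>UNIV. \<Sum>q\<in>UNIV. \<gamma>$l * x$s * B l$i$s * B l$q$k * x$q * h$k) =
          (\<Sum>k\<in>UNIV. \<Sum>q\<in>UNIV. \<Sum>s\<in>UNIV. \<gamma>$l * x$s * B l$i$s * B l$q$k * x$q * h$k)"
        by (intro sum.cong refl sum.swap)
      also have "\<dots> = (\<Sum>q\<in>UNIV. \<Sum>k\<in>UNIV. \<Sum>s\<in>UNIV. \<gamma>$l * x$s * B l$i$s * B l$q$k * x$q * h$k)"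
        by (rule sum.swap)
      also have "\<dots> = \<gamma>$l * (x \<bullet> (B l *v h)) * (B l *v x) $ i"
        by (simp add: matrix_vector_mult_def inner_vec_def sum_distrib_left sum_distrib_right
            mult_ac)
      finally show "(\<Sum>k\<in>UNIV. \<Sum>s\<in>UNIV. \<Sum>q\<in>UNIV. \<gamma>$l * x$s * B l$i$s * B l$q$k * x$q * h$k) =
          \<gamma>$l * (x \<bullet> (B l *v h)) * (B l *v x) $ i" .
    qed
    finally show ?thesis
      by simp
  qed
  then show ?thesis
    by (simp add: vec_eq_iff)
qed

lemma has_derivative_matrix_vector_mult:
  fixes S :: "real^'n^'m"
  shows "((*v) S has_derivative (*v) S) F"
  by (rule bounded_linear_imp_has_derivative[OF matrix_vector_mul_bounded_linear])

lemma GDERIV_quadratic_form: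
  fixes S :: "real^'n^'n"
  assumes "transpose S = S"
  shows "GDERIV (\<lambda>x. x \<bullet> (S *v x)) x :> 2 *\<^sub>R (S *v x)"
proof -
  have "(\<lambda>h. x \<bullet> (S *v h) + h \<bullet> (S *v x)) = (\<lambda>h. h \<bullet> (2 *\<^sub>R (S *v x)))"
    proof
    fix h
    show "x \<bullet> (S *v h) + h \<bullet> (S *v x) = h \<bullet> (2 *\<^sub>R (S *v x))"
      using inner_symmetric_matrix[OF assms, of x h] by simp
  qed
  moreover have "((\<lambda>x. x \<bullet> (S *v x)) has_derivative (\<lambda>h. x \<bullet> (S *v h) + h \<bullet> (S *v x))) (at x)"
    by (rule has_derivative_inner[OF has_derivative_ident has_derivative_matrix_vector_mult])
  ultimately show ?thesis
    unfolding gderiv_def by simp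
qed

lemma has_derivative_half_square:
  fixes q :: "'a::real_normed_vector \<Rightarrow> real"
  assumes "(q has_derivative q') (at x)"
  shows "((\<lambda>y. a / 2 * (q y / 2 + b)\<^sup>2) has_derivative (\<lambda>h. a * (q x / 2 + b) * q' h / 2)) (at x)"
  using assms by (auto intro!: derivative_eq_intros)

locale dual_data =
  fixes A :: "real^'n^'n" and B :: "'m::finite \<Rightarrow> real^'n^'n"
    and c \<gamma> :: "real^'m" and f :: "real^'n" and K :: real
  assumes A_sym: "transpose A = A"
    and B_sym: "\<And>j. transpose (B j) = B j"
    and \<gamma>_pos: "\<And>j. \<gamma>$j > 0"
    and K_gt_A: "pos_def (mat K - A)"
begin

abbreviation "w \<equiv> v0_hat B c \<gamma>"
abbreviation "p \<equiv> v_hat B c \<gamma> K"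
abbreviation "\<Psi> \<equiv> \<lambda>x. G2 B c \<gamma> K x 0"
abbreviation "Q \<equiv> mat K - A"

text \<open>Product rule for \<open>p\<close>: \<open>M_hat\<close> comes from the terms with
  \<open>w\<close> held fixed, \<open>B_hat\<close> from differentiating \<open>w\<close>.\<close>

definition H :: "real^'n \<Rightarrow> real^'n^'n" where
  "H x = M_hat B c \<gamma> K x + B_hat B \<gamma> x"

lemma Q_sym: "transpose Q = Q"
  using A_sym by (simp add: transpose_def vec_eq_iff mat_def)

lemma H_mult_vec: "H x *v h =
    (\<Sum>j\<in>UNIV. w x $ j *\<^sub>R (B j *v h)) + K *\<^sub>R h
      + (\<Sum>j\<in>UNIV. (\<gamma>$j * (x \<bullet> (B j *v h))) *\<^sub>R (B j *v x))"
proof -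
  have "(\<Sum>j\<in>S. u$j *\<^sub>R B j) *v h = (\<Sum>j\<in>S. u$j *\<^sub>R (B j *v h))" for S u
    by (induction S rule: infinite_finite_induct)
      (auto simp: matrix_vector_mult_add_rdistrib scaleR_matrix_vector_assoc[symmetric])
  then show ?thesis
    by (simp add: H_def M_hat_def M_mat_def matrix_vector_mult_add_rdistrib mat_mult_vec
        B_hat_mult_vec)
qed

text \<open>Symmetry of each \<open>B l\<close> turns the rank-one terms into squares with weights
  \<open>\<gamma>$l\<close>.\<close>

lemma B_hat_form_ge_0: "0 \<le> h \<bullet> (B_hat B \<gamma> x *v h)"
proof -
  have "h \<bullet> (B_hat B \<gamma> x *v h) = (\<Sum>l\<in>UNIV. \<gamma>$l * (x \<bullet> (B l *v h))\<^sup>2)"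
    unfolding B_hat_mult_vec inner_sum_right
    by (intro sum.cong refl)
      (simp add: power2_eq_square inner_symmetric_matrix[OF B_sym, of h _ x])
  also have "\<dots> \<ge> 0"
    using \<gamma>_pos by (intro sum_nonneg mult_nonneg_nonneg) (auto intro: less_imp_le)
  finally show ?thesis .
qed

text \<open>Serves twice: with \<open>R\<close> equal to \<open>M_hat\<close> for the Hessian of
  \<open>\<Psi>\<close>, and with \<open>M_hat\<close> minus \<open>Q\<close> for that of
  \<open>J_fun\<close>.\<close>

lemma pos_def_add_B_hat:
  assumes "pos_def R"
  shows "pos_def (R + B_hat B \<gamma> x)"
  using assms B_hat_form_ge_0[of _ x] unfolding pos_def_def
  by (auto simp: matrix_vector_mult_add_rdistrib inner_add_right intro!: add_pos_nonneg)

lemma H_sym: "transpose (H x) = H x"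
proof -
  have B: "B l $ i $ k = B l $ k $ i" for l i k
    using arg_cong[OF B_sym[of l], of "\<lambda>X. X $ k $ i"] by (simp add: transpose_def)
  have "B_hat B \<gamma> x $ k $ j = B_hat B \<gamma> x $ j $ k" for j k
  proof -
    have "(\<Sum>s\<in>UNIV. \<Sum>q\<in>UNIV. \<gamma>$l * x$s * B l$k$s * B l$q$j * x$q)
        = (\<Sum>q\<in>UNIV. \<Sum>s\<in>UNIV. \<gamma>$l * x$s * B l$k$s * B l$q$j * x$q)" for l
      by (rule sum.swap)
    also have "\<dots> l = (\<Sum>s\<in>UNIV. \<Sum>q\<in>UNIV. \<gamma>$l * x$s * B l$j$s * B l$q$k * x$q)" for l
      by (intro sum.cong refl) (simp add: B[of l j] B[of l k] mult_ac)
    finally show ?thesis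
      by (simp add: B_hat_def)
  qed
  moreover have "M_hat B c \<gamma> K x $ k $ j = M_hat B c \<gamma> K x $ j $ k" for j k
    using arg_cong[OF transpose_M_mat[of B K "w x", OF B_sym], of "\<lambda>X. X $ j $ k"]
    by (simp add: transpose_def M_hat_def)
  ultimately show ?thesis
    by (simp add: transpose_def vec_eq_iff H_def)
qed

lemma pos_def_H:
  assumes "w x \<in> C_star B K"
  shows "pos_def (H x)"
  using assms unfolding H_def by (intro pos_def_add_B_hat) (simp add: C_star_def M_hat_def)

lemma GDERIV_Psi: "GDERIV \<Psi> x :> p x"
  unfolding gderiv_def
proof (rule has_derivative_eq_rhs)
  have "((\<lambda>y. \<gamma>$j / 2 * (y \<bullet> (B j *v y) / 2 + c$j)\<^sup>2) has_derivative
      (\<lambda>h. \<gamma>$j * (x \<bullet> (B j *v x) / 2 + c$j) * (h \<bullet> (2 *\<^sub>R (B j *v x))) / 2)) (at x)" for j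
    using GDERIV_quadratic_form[OF B_sym] unfolding gderiv_def by (rule has_derivative_half_square)
  then have "((\<lambda>y. (\<Sum>j\<in>UNIV. \<gamma>$j / 2 * (y \<bullet> (B j *v y) / 2 + c$j)\<^sup>2) + K / 2 * (y \<bullet> y))
      has_derivative (\<lambda>h. (\<Sum>j\<in>UNIV. \<gamma>$j * (x \<bullet> (B j *v x) / 2 + c$j) * (h \<bullet> (2 *\<^sub>R (B j *v x))) / 2)
        + K / 2 * (x \<bullet> h + h \<bullet> x))) (at x)"
    by (intro has_derivative_add has_derivative_sum has_derivative_mult_right has_derivative_inner
        has_derivative_ident) auto
  then show "(\<Psi> has_derivative (\<lambda>h. (\<Sum>j\<in>UNIV. \<gamma>$j * (x \<bullet> (B j *v x) / 2 + c$j) *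
      (h \<bullet> (2 *\<^sub>R (B j *v x))) / 2) + K / 2 * (x \<bullet> h + h \<bullet> x))) (at x)"
    unfolding G2_def by simp
qed (simp add: fun_eq_iff v_hat_def v0_hat_def inner_add_right inner_sum_right inner_commute
    mult.assoc)

lemma w_has_derivative: "((\<lambda>y. w y $ j) has_derivative (\<lambda>h. \<gamma>$j * (x \<bullet> (B j *v h)))) (at x)"
proof (rule has_derivative_eq_rhs)
  show "((\<lambda>y. w y $ j) has_derivative (\<lambda>h. \<gamma>$j * ((h \<bullet> (2 *\<^sub>R (B j *v x))) / 2 + 0))) (at x)"
    unfolding v0_hat_def vec_lambda_beta
    by (intro has_derivative_mult_right has_derivative_add has_derivative_const
        bounded_linear.has_derivative[OF bounded_linear_divide]
        GDERIV_quadratic_form[OF B_sym, unfolded gderiv_def])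
  show "(\<lambda>h. \<gamma>$j * ((h \<bullet> (2 *\<^sub>R (B j *v x))) / 2 + 0)) = (\<lambda>h. \<gamma>$j * (x \<bullet> (B j *v h)))"
  proof
    fix h
    show "\<gamma>$j * ((h \<bullet> (2 *\<^sub>R (B j *v x))) / 2 + 0) = \<gamma>$j * (x \<bullet> (B j *v h))"
      using inner_symmetric_matrix[OF B_sym[of j], of x h] by simp
  qed
qed

lemma continuous_on_w: "continuous_on UNIV w"
  unfolding v0_hat_def by (intro continuous_intros) auto

lemma p_has_derivative: "(p has_derivative (*v) (H x)) (at x)"
  unfolding v_hat_def
  by (auto intro!: derivative_eq_intros w_has_derivative
        has_derivative_matrix_vector_mult
      simp: H_mult_vec fun_eq_iff sum.distrib)

lemma J_fun_eq: "J_fun A B c \<gamma> f x = \<Psi> x - G1 A f K x"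
  by (simp add: J_fun_def G2_def G1_def)

lemma GDERIV_G1: "GDERIV (G1 A f K) x :> Q *v x - f"
proof -
  have "G1 A f K = (\<lambda>x. 1 / 2 * (x \<bullet> (Q *v x)) - x \<bullet> f)"
    by (simp add: fun_eq_iff G1_def matrix_vector_mult_diff_rdistrib mat_mult_vec
        inner_diff_right inner_commute field_simps)
  moreover have "GDERIV (\<lambda>x. 1 / 2 * (x \<bullet> (Q *v x)) - x \<bullet> f) x :> Q *v x - f"
    unfolding gderiv_def
  proof (rule has_derivative_eq_rhs)
    show "((\<lambda>x. 1 / 2 * (x \<bullet> (Q *v x)) - x \<bullet> f) has_derivative
        (\<lambda>h. 1 / 2 * (h \<bullet> (2 *\<^sub>R (Q *v x))) - h \<bullet> f)) (at x)"
      by (intro has_derivative_diff has_derivative_mult_right has_derivative_inner_left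
          has_derivative_ident GDERIV_quadratic_form[OF Q_sym, unfolded gderiv_def])
  qed (simp add: fun_eq_iff inner_diff_right)
  ultimately show ?thesis
    by simp
qed

lemma GDERIV_J: "GDERIV (J_fun A B c \<gamma> f) x :> p x - (Q *v x - f)"
proof -
  have "J_fun A B c \<gamma> f = (\<lambda>x. \<Psi> x - G1 A f K x)"
    by (simp add: fun_eq_iff J_fun_eq)
  then show ?thesis
    using GDERIV_diff[OF GDERIV_Psi GDERIV_G1] by simp
qed

lemma gradient_J_has_derivative:
  "((\<lambda>x. p x - (Q *v x - f)) has_derivative (*v) (H x - Q)) (at x)"
proof -
  have "((\<lambda>x. p x - (Q *v x - f)) has_derivative (\<lambda>h. H x *v h - (Q *v h - 0))) (at x)"
    by (intro has_derivative_diff has_derivative_const has_derivative_matrix_vector_mult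
        p_has_derivative)
  moreover have "(*v) (H x - Q) = (\<lambda>h. H x *v h - (Q *v h - 0))"
    by (simp add: fun_eq_iff matrix_vector_mult_diff_rdistrib)
  ultimately show ?thesis
    by simp
qed

lemma hessian_J: "hessian (J_fun A B c \<gamma> f) x = H x - Q"
  using GDERIV_J gradient_J_has_derivative by (intro hessian_eqI) auto

section \<open>The dual functions near a critical point\<close>

text \<open>\<open>Q *v x - f\<close> is the gradient of \<open>G1\<close> at \<open>x\<close>, the
  case of equality in Fenchel-Young.\<close>

lemma G1_star_gradient: "G1_star A f K (Q *v x - f) = (Q *v x - f) \<bullet> x - G1 A f K x"
proof -
  have "G1_star A f K (Q *v x - f) = (Q *v x) \<bullet> x / 2"
    unfolding G1_star_form(1)[OF A_sym K_gt_A] diff_add_cancel matrix_inv_mult_vec_left[OF K_gt_A] ..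
  then show ?thesis
    by (simp add: G1_def matrix_vector_mult_diff_rdistrib mat_mult_vec inner_diff_left
        inner_add_right inner_diff_right inner_commute field_simps)
qed

text \<open>Testing the supremum at the pair \<open>(x, 0)\<close> gives a bound that does not
  depend on \<open>u\<close>.\<close>

lemma G2_star_ge:
  assumes "u \<in> C_star B K"
  shows "v \<bullet> x - \<Psi> x \<le> G2_star B c \<gamma> K v u"
proof -
  have "(case (x, 0) of (x, y) \<Rightarrow> v \<bullet> x + u \<bullet> y - G2 B c \<gamma> K x y) \<le> G2_star B c \<gamma> K v u"
    unfolding G2_star_def
    using G2_star_form(2)[OF B_sym \<gamma>_pos assms] by (intro cSUP_upper) auto
  then show ?thesis
    by simp
qed

text \<open>\<^const>\<open>v0_hat\<close> at \<open>x\<close> is the stationary point of \<open>G2_star (p x)\<close>, which there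
  takes the value of the Legendre transform of \<open>\<Psi>\<close>.\<close>

lemma G2_star_w:
  assumes "w x \<in> C_star B K"
  shows "G2_star B c \<gamma> K (p x) (w x) = p x \<bullet> x - \<Psi> x"
proof -
  have M: "pos_def (M_hat B c \<gamma> K x)"
    using assms by (simp add: C_star_def M_hat_def)
  \<comment> \<open>Both identities follow from
    \<open>x \<bullet> (B j *v x) / 2 + c$j = w x $ j / \<gamma>$j\<close>.\<close>
  have wj: "w x $ j * (x \<bullet> (B j *v x)) / 2
      = (w x $ j)\<^sup>2 / \<gamma>$j - c$j * w x $ j"
    "\<gamma>$j / 2 * (x \<bullet> (B j *v x) / 2 + c$j)\<^sup>2 = (w x $ j)\<^sup>2 / (2 * \<gamma>$j)" for j
    using \<gamma>_pos[of j] by (simp_all add: v0_hat_def field_simps power2_eq_square)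
  have px: "p x \<bullet> x = (\<Sum>j\<in>UNIV. w x $ j * (x \<bullet> (B j *v x))) + K * (x \<bullet> x)"
    by (simp add: v_hat_eq M_hat_def M_mat_form inner_commute)
  have "(\<Sum>j\<in>UNIV. w x $ j * (x \<bullet> (B j *v x))) / 2
      = (\<Sum>j\<in>UNIV. (w x $ j)\<^sup>2 / \<gamma>$j) - (\<Sum>j\<in>UNIV. c$j * w x $ j)"
    by (simp add: sum_divide_distrib wj sum_subtractf)
  moreover have "(\<Sum>j\<in>UNIV. (w x $ j)\<^sup>2 / \<gamma>$j) = 2 * (\<Sum>j\<in>UNIV. (w x $ j)\<^sup>2 / (2 * \<gamma>$j))"
    by (simp add: sum_distrib_left)
  moreover have "\<Psi> x = (\<Sum>j\<in>UNIV. (w x $ j)\<^sup>2 / (2 * \<gamma>$j)) + K / 2 * (x \<bullet> x)"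
    unfolding G2_def zero_index add_0_right wj ..
  moreover have "G2_star B c \<gamma> K (p x) (w x) = p x \<bullet> x / 2
      + (\<Sum>j\<in>UNIV. (w x $ j)\<^sup>2 / (2 * \<gamma>$j)) - (\<Sum>j\<in>UNIV. c$j * w x $ j)"
    unfolding G2_star_form(1)[OF B_sym \<gamma>_pos assms]
    using matrix_inv_mult_vec_left[OF M, of x] by (simp add: v_hat_eq M_hat_def)
  ultimately show ?thesis
    unfolding px by argo
qed

lemma J_star_le_w:
  assumes "w x \<in> C_star B K" "u \<in> C_star B K"
  shows "J_star A B c \<gamma> f K (p x) u \<le> J_star A B c \<gamma> f K (p x) (w x)"
  using G2_star_ge[OF assms(2), of "p x" x] unfolding J_star_def G2_star_w[OF assms(1)] by simp

text \<open>Stated for any \<open>S\<close> inside \<open>C_star\<close>, so that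
  \<open>J_tilde\<close> and \<open>J2_star\<close> are treated together.\<close>

lemma SUP_J_star:
  assumes "S \<subseteq> C_star B K" "w x \<in> S"
  shows "(SUP u\<in>S. J_star A B c \<gamma> f K (p x) u) = J_star A B c \<gamma> f K (p x) (w x)"
  using assms J_star_le_w by (intro cSup_eq_maximum) auto

lemma SUP_ereal_J_star:
  assumes "S \<subseteq> C_star B K" "S \<noteq> {}"
  shows "(SUP u\<in>S. ereal (J_star A B c \<gamma> f K v u)) = ereal (SUP u\<in>S. J_star A B c \<gamma> f K v u)"
proof -
  have bdd: "bdd_above (J_star A B c \<gamma> f K v ` S)"
    using bdd_above_J_star(1)[of B \<gamma> A c f K v, OF B_sym \<gamma>_pos] image_mono[OF assms(1)]
    by (rule bdd_above_mono)
  obtain a where "a \<in> S"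
    using assms(2) by blast
  have "ereal (J_star A B c \<gamma> f K v a) \<le> (SUP u\<in>S. ereal (J_star A B c \<gamma> f K v u))"
    using \<open>a \<in> S\<close> by (rule SUP_upper)
  moreover have "(SUP u\<in>S. ereal (J_star A B c \<gamma> f K v u))
      \<le> ereal (SUP u\<in>S. J_star A B c \<gamma> f K v u)"
    using bdd by (intro SUP_least) (simp add: cSUP_upper)
  \<comment> \<open>Passing to the real supremum requires finiteness: one member bounds it below,
    \<open>bdd\<close> bounds it above.\<close>
  ultimately have "\<bar>SUP u\<in>S. ereal (J_star A B c \<gamma> f K v u)\<bar> \<noteq> \<infinity>"
    by auto
  then show ?thesis
    by (simp add: ereal_SUP)
qed

lemma open_C_star: "open (C_star B K)"
proof -
  have "continuous_on UNIV (M_mat B K)"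
    unfolding M_mat_def by (intro continuous_intros)
  from open_vimage[OF open_pos_def this] show ?thesis
    by (simp add: C_star_def vimage_def)
qed

lemma open_A_star: "open (A_star A B K)"
proof -
  have "continuous_on UNIV (\<lambda>u :: real^'m. A + (\<Sum>j\<in>UNIV. u$j *\<^sub>R B j))"
    by (intro continuous_intros)
  from open_vimage[OF open_pos_def this] show ?thesis
    unfolding A_star_def by (intro open_Int open_C_star) (simp add: B_star_def vimage_def)
qed

text \<open>No convexity of the domain is needed: with \<open>u = w x\<close>, \<open>u' = w y\<close>, the cross terms
  \<open>\<Sum>(u\<^sub>j - u'\<^sub>j) (x \<bullet> B\<^sub>j x - y \<bullet> B\<^sub>j y)\<close> add up to a multiple of
  \<open>\<Sum>(u\<^sub>j - u'\<^sub>j)\<^sup>2 / \<gamma>\<^sub>j \<ge> 0\<close>.\<close>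

lemma inj_on_p: "inj_on p {x. w x \<in> C_star B K}"
proof (rule inj_onI, clarify)
  fix x y assume x: "w x \<in> C_star B K" and y: "w y \<in> C_star B K" and eq: "p x = p y"
  define M N where "M = M_hat B c \<gamma> K x" and "N = M_hat B c \<gamma> K y"
  have M: "pos_def M" "pos_def N"
    using x y by (auto simp: C_star_def M_hat_def M_def N_def)
  have sym: "transpose M = M" "transpose N = N"
    by (simp_all add: M_def N_def M_hat_def transpose_M_mat B_sym)
  have "M *v x = N *v y"
    using eq by (simp add: v_hat_eq M_def N_def)
  \<comment> \<open>Pairing \<open>M *v x = N *v y\<close> with \<open>x\<close> and with
    \<open>y\<close> eliminates all mixed terms.\<close>
  then have "(x - y) \<bullet> (M *v (x - y)) + (x - y) \<bullet> (N *v (x - y))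
      = - ((x \<bullet> (M *v x) - x \<bullet> (N *v x)) - (y \<bullet> (M *v y) - y \<bullet> (N *v y)))"
    using inner_symmetric_matrix[OF sym(1), of x y] inner_symmetric_matrix[OF sym(2), of x y]
    by (simp add: inner_diff_left inner_diff_right matrix_vector_mult_diff_distrib)
  also have "\<dots> = - (\<Sum>j\<in>UNIV. (w x $ j - w y $ j) * (x \<bullet> (B j *v x) - y \<bullet> (B j *v y)))"
    unfolding M_def N_def M_hat_def M_mat_form
    by (simp add: algebra_simps sum.distrib sum_subtractf)
  also have "\<dots> = - (\<Sum>j\<in>UNIV. 2 * (w x $ j - w y $ j)\<^sup>2 / \<gamma>$j)"
  proof (intro arg_cong[of _ _ uminus] sum.cong refl)
    fix j
    show "(w x $ j - w y $ j) * (x \<bullet> (B j *v x) - y \<bullet> (B j *v y))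
        = 2 * (w x $ j - w y $ j)\<^sup>2 / \<gamma>$j"
      using \<gamma>_pos[of j] by (simp add: v0_hat_def field_simps power2_eq_square)
  qed
  also have "\<dots> \<le> 0"
    using \<gamma>_pos by (simp add: sum_nonneg less_imp_le)
  finally have "\<not> 0 < (x - y) \<bullet> (M *v (x - y))"
    using pos_def_ge_0[OF M(2), of "x - y"] by linarith
  with M(1) show "x = y"
    unfolding pos_def_def by (metis right_minus_eq)
qed

section \<open>The inverse of the gradient map and the Legendre transform\<close>

lemma matrix_inv_comp_id:
  assumes "pos_def R"
  shows "(*v) R \<circ> (*v) (matrix_inv R) = id"
  by (simp add: fun_eq_iff matrix_inv_mult_vec[OF assms])

text \<open>The gradient of the Legendre transform of \<open>\<Psi>\<close>. Injectivity of
  \<open>p\<close> allows one inverse on the whole image; elsewhere the value is arbitrary.\<close>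

definition g :: "real^'n \<Rightarrow> real^'n" where
  "g = inv_into {x. w x \<in> C_star B K} p"

lemma g_p: "w x \<in> C_star B K \<Longrightarrow> g (p x) = x"
  unfolding g_def by (intro inv_into_f_f inj_on_p) simp

lemma open_w_vimage: "open S \<Longrightarrow> open {x. w x \<in> S}"
  using open_vimage[OF _ continuous_on_w] by (simp add: vimage_def)

lemma g_has_derivative:
  assumes "w x \<in> C_star B K"
  shows "(g has_derivative (*v) (matrix_inv (H x))) (at (p x))"
  using assms
  by (intro has_derivative_inverse_on[where S = "{x. w x \<in> C_star B K}"
        and f' = "\<lambda>x. (*v) (H x)" and g' = "\<lambda>x. (*v) (matrix_inv (H x))"]
      open_w_vimage open_C_star p_has_derivative matrix_inv_comp_id pos_def_H)
    (auto simp: g_p)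

text \<open>The two contributions of the derivative of \<open>g\<close> cancel because the gradient
  of \<open>\<Psi>\<close> at \<open>g (p x) = x\<close> is \<open>p x\<close>.\<close>

lemma GDERIV_Legendre:
  assumes "w x \<in> C_star B K"
  shows "GDERIV (\<lambda>v. v \<bullet> g v - \<Psi> (g v)) (p x) :> x"
proof -
  note dg = g_has_derivative[OF assms]
  have "((\<lambda>v. \<Psi> (g v)) has_derivative (\<lambda>h. (matrix_inv (H x) *v h) \<bullet> p x)) (at (p x))"
    using has_derivative_compose[OF dg, of \<Psi>] GDERIV_Psi[of x]
    by (simp add: gderiv_def g_p[OF assms])
  then show ?thesis
    unfolding gderiv_def
    by (auto intro!: derivative_eq_intros dg simp: g_p[OF assms] inner_commute)
qed

lemma GDERIV_G1_star: "GDERIV (G1_star A f K) v :> matrix_inv Q *v (v + f)"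
proof -
  have "G1_star A f K = (\<lambda>v. (v + f) \<bullet> (matrix_inv Q *v (v + f)) / 2)"
    by (simp add: fun_eq_iff G1_star_form(1)[OF A_sym K_gt_A])
  moreover have "GDERIV (\<lambda>v. (v + f) \<bullet> (matrix_inv Q *v (v + f)) / 2) v :> matrix_inv Q *v (v + f)"
    unfolding gderiv_def
  proof (rule has_derivative_eq_rhs)
    have shift: "((\<lambda>v. v + f) has_derivative (\<lambda>h. h)) (at v)"
      by (auto intro!: derivative_eq_intros)
    show "((\<lambda>v. (v + f) \<bullet> (matrix_inv Q *v (v + f)) / 2) has_derivative
        (\<lambda>h. ((v + f) \<bullet> (matrix_inv Q *v h) + h \<bullet> (matrix_inv Q *v (v + f))) / 2)) (at v)"
      by (intro bounded_linear.has_derivative[OF bounded_linear_divide] has_derivative_inner shift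
          has_derivative_compose[OF shift has_derivative_matrix_vector_mult])
    show "(\<lambda>h. ((v + f) \<bullet> (matrix_inv Q *v h) + h \<bullet> (matrix_inv Q *v (v + f))) / 2)
        = (\<lambda>h. h \<bullet> (matrix_inv Q *v (v + f)))"
    proof
      fix h
      show "((v + f) \<bullet> (matrix_inv Q *v h) + h \<bullet> (matrix_inv Q *v (v + f))) / 2
          = h \<bullet> (matrix_inv Q *v (v + f))"
        using inner_matrix_inv_symmetric[OF K_gt_A Q_sym, of "v + f" h] by simp
    qed
  qed
  ultimately show ?thesis
    by simp
qed

text \<open>Invariance of domain supplies the neighbourhoods of \<open>p x\<close> on which the dual
  suprema can be computed.\<close>

lemma open_p_image:
  assumes "open S" "S \<subseteq> C_star B K"
  shows "open (p ` {x. w x \<in> S})"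
proof (rule invariance_of_domain)
  show "continuous_on {x. w x \<in> S} p"
    using p_has_derivative has_derivative_continuous continuous_at_imp_continuous_on by blast
  show "inj_on p {x. w x \<in> S}"
    using assms(2) by (intro inj_on_subset[OF inj_on_p]) auto
qed (rule open_w_vimage[OF assms(1)])

text \<open>On the open image of \<open>{x. w x \<in> S}\<close> the supremum is attained at
  \<open>w y\<close> for \<open>v = p y\<close>, so it equals \<open>G1_star\<close> minus the
  Legendre transform.\<close>

lemma GDERIV_dual:
  assumes S: "open S" "S \<subseteq> C_star B K" "w x \<in> S"
  shows "GDERIV (\<lambda>v. SUP u\<in>S. J_star A B c \<gamma> f K v u) (p x) :> matrix_inv Q *v (p x + f) - x"
proof -
  have C: "w x \<in> C_star B K"
    using S by blast
  have "GDERIV (\<lambda>v. G1_star A f K v - (v \<bullet> g v - \<Psi> (g v))) (p x)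
      :> matrix_inv Q *v (p x + f) - x"
    by (intro GDERIV_diff GDERIV_G1_star GDERIV_Legendre C)
  then show ?thesis
    unfolding gderiv_def
  proof (rule has_derivative_transform_within_open[OF _ open_p_image[OF S(1,2)]])
    fix v assume "v \<in> p ` {x. w x \<in> S}"
    then obtain y where y: "w y \<in> S" "v = p y"
      by blast
    then have "w y \<in> C_star B K"
      using S(2) by blast
    then show "G1_star A f K v - (v \<bullet> g v - \<Psi> (g v)) = (SUP u\<in>S. J_star A B c \<gamma> f K v u)"
      unfolding y(2) SUP_J_star[OF S(2) y(1)] unfolding J_star_def by (simp add: G2_star_w g_p)
  qed (use S(3) in blast)
qed

lemma eventually_GDERIV_dual:
  assumes S: "open S" "S \<subseteq> C_star B K" "w x \<in> S"
  shows "\<forall>\<^sub>F v in nhds (p x). GDERIV (\<lambda>v. SUP u\<in>S. J_star A B c \<gamma> f K v u) v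
    :> matrix_inv Q *v (v + f) - g v"
  unfolding eventually_nhds
proof (intro exI conjI ballI)
  show "open (p ` {x. w x \<in> S})"
    by (rule open_p_image[OF S(1,2)])
  fix v assume "v \<in> p ` {x. w x \<in> S}"
  then obtain y where y: "w y \<in> S" "v = p y"
    by blast
  then have "g v = y"
    using S(2) g_p by blast
  with GDERIV_dual[OF S(1,2) y(1)] y(2)
  show "GDERIV (\<lambda>v. SUP u\<in>S. J_star A B c \<gamma> f K v u) v :> matrix_inv Q *v (v + f) - g v"
    by simp
qed (use S(3) in blast)

lemma gradient_dual_has_derivative:
  assumes "w x \<in> C_star B K"
  shows "((\<lambda>v. matrix_inv Q *v (v + f) - g v) has_derivative
    (*v) (matrix_inv Q - matrix_inv (H x))) (at (p x))"
proof -
  have "((\<lambda>v. matrix_inv Q *v v + matrix_inv Q *v f - g v) has_derivative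
      (\<lambda>h. matrix_inv Q *v h + 0 - matrix_inv (H x) *v h)) (at (p x))"
    by (intro has_derivative_diff has_derivative_add has_derivative_const
        has_derivative_matrix_vector_mult g_has_derivative[OF assms])
  moreover have "(*v) (matrix_inv Q - matrix_inv (H x))
      = (\<lambda>h. matrix_inv Q *v h + 0 - matrix_inv (H x) *v h)"
    by (simp add: fun_eq_iff matrix_vector_mult_diff_rdistrib)
  ultimately show ?thesis
    by (simp only: matrix_vector_right_distrib)
qed

text \<open>Stationarity means that \<open>\<Psi>\<close> and \<open>G1\<close> have the same
  gradient at \<open>x\<close>.\<close>

lemma critical_iff: "GDERIV (J_fun A B c \<gamma> f) x :> 0 \<longleftrightarrow> p x + f = Q *v x"
proof -
  have "GDERIV (J_fun A B c \<gamma> f) x :> 0 \<longleftrightarrow> p x - (Q *v x - f) = 0"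
    using GDERIV_J[of x] gradient_eqI by metis
  then show ?thesis
    by (simp add: algebra_simps)
qed

text \<open>At a critical point \<open>p x\<close> is also the gradient of \<open>G1\<close>, so
  both conjugates are attained at \<open>x\<close> and the terms \<open>p x \<bullet> x\<close>
  cancel.\<close>

lemma J_star_critical:
  assumes "GDERIV (J_fun A B c \<gamma> f) x :> 0" "w x \<in> C_star B K"
  shows "J_star A B c \<gamma> f K (p x) (w x) = J_fun A B c \<gamma> f x"
proof -
  have "p x = Q *v x - f"
    using assms(1) by (simp add: critical_iff eq_diff_eq)
  then have "G1_star A f K (p x) = p x \<bullet> x - G1 A f K x"
    using G1_star_gradient[of x] by simp
  then show ?thesis
    by (simp add: J_star_def G2_star_w[OF assms(2)] J_fun_eq)
qed

lemma dual_critical: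
  assumes crit: "GDERIV (J_fun A B c \<gamma> f) x :> 0"
    and S: "open S" "S \<subseteq> C_star B K" "w x \<in> S"
  defines "F \<equiv> \<lambda>v. SUP u\<in>S. J_star A B c \<gamma> f K v u"
  shows "GDERIV F (p x) :> 0"
    and "twice_differentiable_at F (p x)"
    and "hessian F (p x) = matrix_inv Q - matrix_inv (H x)"
    and "F (p x) = J_fun A B c \<gamma> f x"
    and "pos_def (hessian F (p x)) \<Longrightarrow> \<exists>r>0. \<forall>v\<in>ball (p x) r. F (p x) \<le> F v"
    and "neg_def (hessian F (p x)) \<Longrightarrow> \<exists>r>0. \<forall>v\<in>ball (p x) r. F v \<le> F (p x)"
proof -
  have C: "w x \<in> C_star B K"
    using S by blast
  \<comment> \<open>This is the dual gradient at \<open>p x\<close>, where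
    \<open>g (p x) = x\<close>.\<close>
  have zero: "matrix_inv Q *v (p x + f) - x = 0"
    using crit by (simp add: critical_iff matrix_inv_mult_vec_left[OF K_gt_A])
  show "GDERIV F (p x) :> 0"
    using GDERIV_dual[OF S] unfolding F_def zero .
  have ev: "\<forall>\<^sub>F v in nhds (p x). GDERIV F v :> matrix_inv Q *v (v + f) - g v"
    unfolding F_def by (rule eventually_GDERIV_dual[OF S])
  note dF = gradient_dual_has_derivative[OF C]
  show "twice_differentiable_at F (p x)"
    using ev dF by (rule twice_differentiable_atI)
  show hess: "hessian F (p x) = matrix_inv Q - matrix_inv (H x)"
    using ev dF by (rule hessian_eqI)
  show "F (p x) = J_fun A B c \<gamma> f x"
    unfolding F_def SUP_J_star[OF S(2,3)] by (rule J_star_critical[OF crit C])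
  show "\<exists>r>0. \<forall>v\<in>ball (p x) r. F (p x) \<le> F v" if "pos_def (hessian F (p x))"
    using second_order_local_min[OF ev dF] zero that unfolding hess g_p[OF C] by metis
  show "\<exists>r>0. \<forall>v\<in>ball (p x) r. F v \<le> F (p x)" if "neg_def (hessian F (p x))"
    using second_order_local_max[OF ev dF] zero that unfolding hess g_p[OF C] by metis
qed

lemma primal_local_min:
  assumes "GDERIV (J_fun A B c \<gamma> f) x :> 0" "pos_def (hessian (J_fun A B c \<gamma> f) x)"
  shows "\<exists>r>0. \<forall>y\<in>ball x r. J_fun A B c \<gamma> f x \<le> J_fun A B c \<gamma> f y"
proof -
  have "p x - (Q *v x - f) = 0"
    using assms(1) by (simp add: critical_iff eq_diff_eq)
  then show ?thesis
    using second_order_local_min[OF always_eventually gradient_J_has_derivative] GDERIV_J assms(2)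
    unfolding hessian_J by metis
qed

lemma primal_local_max:
  assumes "GDERIV (J_fun A B c \<gamma> f) x :> 0" "neg_def (hessian (J_fun A B c \<gamma> f) x)"
  shows "\<exists>r>0. \<forall>y\<in>ball x r. J_fun A B c \<gamma> f y \<le> J_fun A B c \<gamma> f x"
proof -
  have "p x - (Q *v x - f) = 0"
    using assms(1) by (simp add: critical_iff eq_diff_eq)
  then show ?thesis
    using second_order_local_max[OF always_eventually gradient_J_has_derivative] GDERIV_J assms(2)
    unfolding hessian_J by metis
qed

lemma pos_def_dual_hessian:
  assumes "w x \<in> C_star B K" "pos_def (hessian (J_fun A B c \<gamma> f) x)"
  shows "pos_def (matrix_inv Q - matrix_inv (H x))"
  using assms(2) unfolding hessian_J
  by (intro pos_def_matrix_inv_diff K_gt_A Q_sym pos_def_H assms(1))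

text \<open>Here \<open>Q\<close> exceeds \<open>H x\<close>, so the two exchange roles and the
  symmetry of \<open>H x\<close> enters.\<close>

lemma neg_def_dual_hessian:
  assumes "w x \<in> C_star B K" "neg_def (hessian (J_fun A B c \<gamma> f) x)"
  shows "neg_def (matrix_inv Q - matrix_inv (H x))"
  using pos_def_matrix_inv_diff[OF pos_def_H[OF assms(1)] H_sym K_gt_A] assms(2)
  unfolding hessian_J neg_def_def minus_diff_eq .

section \<open>Global duality on \<open>A\<^sup>*\<close>\<close>

text \<open>The multiples of the identity in \<open>M_mat\<close> and \<open>Q\<close> cancel, so
  membership in \<open>B_star\<close> says that \<open>M_mat\<close> exceeds
  \<open>Q\<close>.\<close>

lemma A_star_iff: "u \<in> A_star A B K \<longleftrightarrow> u \<in> C_star B K \<and> pos_def (M_mat B K u - Q)"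
proof -
  have "A + (\<Sum>j\<in>UNIV. u$j *\<^sub>R B j) = M_mat B K u - Q"
    by (simp add: M_mat_def)
  then have "u \<in> B_star A B \<longleftrightarrow> pos_def (M_mat B K u - Q)"
    by (simp only: B_star_def mem_Collect_eq)
  then show ?thesis
    by (simp only: A_star_def Int_iff conj_commute)
qed

lemma pos_def_hessian_J:
  assumes "w x \<in> A_star A B K"
  shows "pos_def (hessian (J_fun A B c \<gamma> f) x)"
proof -
  have "hessian (J_fun A B c \<gamma> f) x = (M_hat B c \<gamma> K x - Q) + B_hat B \<gamma> x"
    by (simp add: hessian_J H_def)
  with assms show ?thesis
    by (simp only: A_star_iff M_hat_def pos_def_add_B_hat)
qed

text \<open>For fixed \<open>u \<in> A\<^sup>*\<close> the function \<open>J_star v u\<close> is a convex quadratic in \<open>v\<close>.\<close>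

lemma quadratic_form_add:
  fixes R :: "real^'n^'n"
  assumes "R *v q = y" "q \<bullet> (R *v d) = d \<bullet> (R *v q)"
  shows "(q + d) \<bullet> (R *v (q + d)) = q \<bullet> y + 2 * (d \<bullet> y) + d \<bullet> (R *v d)"
  using assms by (simp add: matrix_vector_right_distrib inner_add_left inner_add_right)

text \<open>Expanded around \<open>p x\<close>, the linear terms cancel and half the form of
  \<open>matrix_inv Q - matrix_inv M\<close> remains, which is nonnegative by order
  reversal.\<close>

lemma J_star_critical_le:
  assumes crit: "GDERIV (J_fun A B c \<gamma> f) x :> 0" and u: "w x \<in> A_star A B K"
  shows "J_star A B c \<gamma> f K (p x) (w x) \<le> J_star A B c \<gamma> f K v (w x)"
proof -
  define M where "M = M_mat B K (w x)"
  have C: "w x \<in> C_star B K" and M: "pos_def M" and less: "pos_def (M - Q)"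
    using u by (auto simp: A_star_iff C_star_def M_def)
  have M_sym: "transpose M = M"
    unfolding M_def by (rule transpose_M_mat[OF B_sym])
  define d where "d = v - p x"
  have v: "v = p x + d"
    by (simp add: d_def)
  \<comment> \<open>The two quadratics have the same slope \<open>x\<close> at \<open>p x\<close>:
    this and \<open>Mx\<close> are why the linear terms agree.\<close>
  have Qx: "matrix_inv Q *v (p x + f) = x"
    using crit by (simp add: critical_iff matrix_inv_mult_vec_left[OF K_gt_A])
  have Mx: "matrix_inv M *v p x = x"
    using matrix_inv_mult_vec_left[OF M, of x] by (simp add: v_hat_eq M_hat_def M_def)
  have "v + f = (p x + f) + d"
    by (simp add: v)
  then have "(v + f) \<bullet> (matrix_inv Q *v (v + f))
      = (p x + f) \<bullet> x + 2 * (d \<bullet> x) + d \<bullet> (matrix_inv Q *v d)"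
    by (simp only: quadratic_form_add[OF Qx inner_matrix_inv_symmetric[OF K_gt_A Q_sym]])
  moreover have "v \<bullet> (matrix_inv M *v v) = p x \<bullet> x + 2 * (d \<bullet> x) + d \<bullet> (matrix_inv M *v d)"
    unfolding v by (rule quadratic_form_add[OF Mx inner_matrix_inv_symmetric[OF M M_sym]])
  moreover have "d \<bullet> (matrix_inv M *v d) \<le> d \<bullet> (matrix_inv Q *v d)"
    using pos_def_ge_0[OF pos_def_matrix_inv_diff[OF K_gt_A Q_sym M less], of d]
    by (simp add: matrix_vector_mult_diff_rdistrib inner_diff_right)
  ultimately show ?thesis
    unfolding J_star_def G1_star_form(1)[OF A_sym K_gt_A] G2_star_form(1)[OF B_sym \<gamma>_pos C]
      M_def[symmetric] Qx Mx
    by argo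
qed

lemma dual_global_min:
  assumes "GDERIV (J_fun A B c \<gamma> f) x :> 0" "w x \<in> A_star A B K"
  shows "J_fun A B c \<gamma> f x \<le> (SUP u\<in>A_star A B K. J_star A B c \<gamma> f K v u)"
proof -
  have "J_fun A B c \<gamma> f x \<le> J_star A B c \<gamma> f K v (w x)"
    using J_star_critical_le[OF assms] J_star_critical[OF assms(1)] assms(2)
    by (simp add: A_star_iff)
  also have "\<dots> \<le> (SUP u\<in>A_star A B K. J_star A B c \<gamma> f K v u)"
    using bdd_above_J_star(2)[of B \<gamma> A c f K v, OF B_sym \<gamma>_pos] assms(2) by (rule cSUP_upper[rotated])
  finally show ?thesis .
qed

text \<open>Weak duality, read off at the dual point \<open>v = Q y - f\<close> where \<open>G1_star\<close> is attained.\<close>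

lemma J_star_le_J_fun:
  assumes "u \<in> C_star B K"
  shows "J_star A B c \<gamma> f K (Q *v y - f) u \<le> J_fun A B c \<gamma> f y"
  using G2_star_ge[OF assms, of "Q *v y - f" y]
  by (simp add: J_star_def G1_star_gradient J_fun_eq)

text \<open>The dual value at \<open>(Q *v y - f, w x)\<close> lies between the two primal
  values.\<close>

lemma primal_global_min:
  assumes "GDERIV (J_fun A B c \<gamma> f) x :> 0" "w x \<in> A_star A B K"
  shows "J_fun A B c \<gamma> f x \<le> J_fun A B c \<gamma> f y"
proof -
  have C: "w x \<in> C_star B K"
    using assms(2) by (simp add: A_star_iff)
  show ?thesis
    using J_star_critical_le[OF assms, of "Q *v y - f"] J_star_le_J_fun[OF C, of y]
    unfolding J_star_critical[OF assms(1) C] by linarith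
qed

end

section \<open>The local minimum, global minimum and local maximum duality principles\<close>

theorem theorem2p2:
  fixes A :: "real^'n^'n" and B :: "'m::finite \<Rightarrow> real^'n^'n"
    and c \<gamma> :: "real^'m" and f x0 :: "real^'n" and K :: real
  assumes A_sym: "transpose A = A"
    and B_sym: "\<And>j. transpose (B j) = B j"
    and \<gamma>_pos: "\<And>j. \<gamma>$j > 0"
    and coercive: "filterlim (J_fun A B c \<gamma> f) at_top at_infinity"
    and K_pos: "K > 0"
    and K_gt_A: "pos_def (mat K - A)"
    and critical: "GDERIV (J_fun A B c \<gamma> f) x0 :> 0"
  shows
   "(pos_def (hessian (J_fun A B c \<gamma> f) x0)
      \<and> pos_def (hessian (J_fun A B c \<gamma> f) x0 + (mat K - A) ** alpha1 B c \<gamma> K x0)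
      \<and> v0_hat B c \<gamma> x0 \<in> C_star B K
     \<longrightarrow>
      GDERIV (J_tilde A B c \<gamma> f K) (v_hat B c \<gamma> K x0) :> 0
      \<and> twice_differentiable_at (J_tilde A B c \<gamma> f K) (v_hat B c \<gamma> K x0)
      \<and> pos_def (hessian (J_tilde A B c \<gamma> f K) (v_hat B c \<gamma> K x0))
      \<and> (\<exists>r>0. \<exists>r1>0.
            ereal (J_fun A B c \<gamma> f x0) = (INF x\<in>ball x0 r. ereal (J_fun A B c \<gamma> f x))
          \<and> (INF x\<in>ball x0 r. ereal (J_fun A B c \<gamma> f x))
              = (INF v\<in>ball (v_hat B c \<gamma> K x0) r1. ereal (J_tilde A B c \<gamma> f K v))
          \<and> (INF v\<in>ball (v_hat B c \<gamma> K x0) r1. ereal (J_tilde A B c \<gamma> f K v))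
              = ereal (J_tilde A B c \<gamma> f K (v_hat B c \<gamma> K x0))
          \<and> ereal (J_tilde A B c \<gamma> f K (v_hat B c \<gamma> K x0))
              = (INF v\<in>ball (v_hat B c \<gamma> K x0) r1.
                   SUP v0\<in>C_star B K. ereal (J_star A B c \<gamma> f K v v0))
          \<and> (INF v\<in>ball (v_hat B c \<gamma> K x0) r1.
                   SUP v0\<in>C_star B K. ereal (J_star A B c \<gamma> f K v v0))
              = ereal (J_star A B c \<gamma> f K (v_hat B c \<gamma> K x0) (v0_hat B c \<gamma> x0))))
  \<and>
    (v0_hat B c \<gamma> x0 \<in> A_star A B K
     \<longrightarrow>
      pos_def (hessian (J_fun A B c \<gamma> f) x0)
      \<and> GDERIV (J2_star A B c \<gamma> f K) (v_hat B c \<gamma> K x0) :> 0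
      \<and> twice_differentiable_at (J2_star A B c \<gamma> f K) (v_hat B c \<gamma> K x0)
      \<and> pos_def (hessian (J2_star A B c \<gamma> f K) (v_hat B c \<gamma> K x0))
      \<and> ereal (J_fun A B c \<gamma> f x0) = (INF x. ereal (J_fun A B c \<gamma> f x))
      \<and> (INF x. ereal (J_fun A B c \<gamma> f x)) = (INF v. ereal (J2_star A B c \<gamma> f K v))
      \<and> (INF v. ereal (J2_star A B c \<gamma> f K v))
          = ereal (J2_star A B c \<gamma> f K (v_hat B c \<gamma> K x0))
      \<and> ereal (J2_star A B c \<gamma> f K (v_hat B c \<gamma> K x0))
          = (INF v. SUP v0\<in>A_star A B K. ereal (J_star A B c \<gamma> f K v v0))
      \<and> (INF v. SUP v0\<in>A_star A B K. ereal (J_star A B c \<gamma> f K v v0))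
          = ereal (J_star A B c \<gamma> f K (v_hat B c \<gamma> K x0) (v0_hat B c \<gamma> x0)))
  \<and>
    (neg_def (hessian (J_fun A B c \<gamma> f) x0)
      \<and> neg_def (hessian (J_fun A B c \<gamma> f) x0 + (mat K - A) ** alpha1 B c \<gamma> K x0)
      \<and> v0_hat B c \<gamma> x0 \<in> C_star B K
     \<longrightarrow>
      GDERIV (J_tilde A B c \<gamma> f K) (v_hat B c \<gamma> K x0) :> 0
      \<and> twice_differentiable_at (J_tilde A B c \<gamma> f K) (v_hat B c \<gamma> K x0)
      \<and> neg_def (hessian (J_tilde A B c \<gamma> f K) (v_hat B c \<gamma> K x0))
      \<and> (\<exists>r>0. \<exists>r1>0.
            ereal (J_fun A B c \<gamma> f x0) = (SUP x\<in>ball x0 r. ereal (J_fun A B c \<gamma> f x))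
          \<and> (SUP x\<in>ball x0 r. ereal (J_fun A B c \<gamma> f x))
              = (SUP v\<in>ball (v_hat B c \<gamma> K x0) r1. ereal (J_tilde A B c \<gamma> f K v))
          \<and> (SUP v\<in>ball (v_hat B c \<gamma> K x0) r1. ereal (J_tilde A B c \<gamma> f K v))
              = ereal (J_tilde A B c \<gamma> f K (v_hat B c \<gamma> K x0))
          \<and> ereal (J_tilde A B c \<gamma> f K (v_hat B c \<gamma> K x0))
              = (SUP v\<in>ball (v_hat B c \<gamma> K x0) r1.
                   SUP v0\<in>C_star B K. ereal (J_star A B c \<gamma> f K v v0))
          \<and> (SUP v\<in>ball (v_hat B c \<gamma> K x0) r1.
                   SUP v0\<in>C_star B K. ereal (J_star A B c \<gamma> f K v v0))
              = ereal (J_star A B c \<gamma> f K (v_hat B c \<gamma> K x0) (v0_hat B c \<gamma> x0))))"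
proof -
  interpret dual_data A B c \<gamma> f K
    by unfold_locales (fact A_sym B_sym \<gamma>_pos K_gt_A)+
  let ?J = "J_fun A B c \<gamma> f" and ?J' = "J_star A B c \<gamma> f K"
    and ?T = "J_tilde A B c \<gamma> f K" and ?T2 = "J2_star A B c \<gamma> f K"
  \<comment> \<open>Identifies the inner extended-real suprema with the real-valued dual functions;
    membership of \<open>w x0\<close> makes the index set nonempty.\<close>
  have SUP_C: "(SUP u\<in>C_star B K. ereal (?J' v u)) = ereal (?T v)" if "w x0 \<in> C_star B K" for v
    unfolding J_tilde_def using that by (intro SUP_ereal_J_star) auto
  have SUP_A: "(SUP u\<in>A_star A B K. ereal (?J' v u)) = ereal (?T2 v)"
    if "w x0 \<in> A_star A B K" for v
    unfolding J2_star_def using that by (intro SUP_ereal_J_star) (auto simp: A_star_iff)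
  note dualC = dual_critical[OF critical open_C_star subset_refl, folded J_tilde_def]
  have "A_star A B K \<subseteq> C_star B K"
    by (auto simp: A_star_def)
  note dualA = dual_critical[OF critical open_A_star this, folded J2_star_def]
  show ?thesis
  proof ((rule conjI[OF _ conjI]; rule impI), goal_cases)
    case 1
    then have pos: "pos_def (hessian ?J x0)" and C: "w x0 \<in> C_star B K"
      by blast+
    have pos': "pos_def (hessian ?T (p x0))"
      unfolding dualC(3)[OF C] by (rule pos_def_dual_hessian[OF C pos])
    obtain r where r: "r > 0" "\<forall>y\<in>ball x0 r. ?J x0 \<le> ?J y"
      using primal_local_min[OF critical pos] by (elim exE conjE)
    obtain r1 where r1: "r1 > 0" "\<forall>v\<in>ball (p x0) r1. ?T (p x0) \<le> ?T v"
      using dualC(5)[OF C pos'] by (elim exE conjE)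
    have J: "(INF x\<in>ball x0 r. ereal (?J x)) = ereal (?J x0)"
      using r by (intro INF_ereal_eq_min) (simp, blast)
    have T: "(INF v\<in>ball (p x0) r1. ereal (?T v)) = ereal (?J x0)"
      using r1 INF_ereal_eq_min[of "p x0" "ball (p x0) r1" ?T] dualC(4)[OF C] by simp
    \<comment> \<open>The radii are independent: every member of the chain rewrites to
      \<open>ereal (?J x0)\<close>.\<close>
    show ?case
      unfolding SUP_C[OF C] J_star_critical[OF critical C] dualC(4)[OF C]
      by (intro conjI dualC(1,2)[OF C] pos', rule exI[of _ r], rule conjI[OF r(1)],
          rule exI[of _ r1], rule conjI[OF r1(1)]) (simp only: J T)
  next
    case 2
    then have C: "w x0 \<in> C_star B K"
      by (simp add: A_star_iff)
    have pos': "pos_def (hessian ?T2 (p x0))"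
      unfolding dualA(3)[OF 2] by (rule pos_def_dual_hessian[OF C pos_def_hessian_J[OF 2]])
    have J: "(INF x. ereal (?J x)) = ereal (?J x0)"
      using primal_global_min[OF critical 2] by (intro INF_ereal_eq_min) auto
    have T: "(INF v. ereal (?T2 v)) = ereal (?J x0)"
      using INF_ereal_eq_min[of "p x0" UNIV ?T2] dual_global_min[OF critical 2, folded J2_star_def]
        dualA(4)[OF 2] by simp
    show ?case
      unfolding SUP_A[OF 2] J_star_critical[OF critical C] dualA(4)[OF 2] J T
      by (intro conjI dualA(1,2)[OF 2] pos' pos_def_hessian_J[OF 2] refl)
  next
    case 3
    then have neg: "neg_def (hessian ?J x0)" and C: "w x0 \<in> C_star B K"
      by blast+
    have neg': "neg_def (hessian ?T (p x0))"
      unfolding dualC(3)[OF C] by (rule neg_def_dual_hessian[OF C neg])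
    obtain r where r: "r > 0" "\<forall>y\<in>ball x0 r. ?J y \<le> ?J x0"
      using primal_local_max[OF critical neg] by (elim exE conjE)
    obtain r1 where r1: "r1 > 0" "\<forall>v\<in>ball (p x0) r1. ?T v \<le> ?T (p x0)"
      using dualC(6)[OF C neg'] by (elim exE conjE)
    have J: "(SUP x\<in>ball x0 r. ereal (?J x)) = ereal (?J x0)"
      using r by (intro SUP_ereal_eq_max) (simp, blast)
    have T: "(SUP v\<in>ball (p x0) r1. ereal (?T v)) = ereal (?J x0)"
      using r1 SUP_ereal_eq_max[of "p x0" "ball (p x0) r1" ?T] dualC(4)[OF C] by simp
    show ?case
      unfolding SUP_C[OF C] J_star_critical[OF critical C] dualC(4)[OF C]
      by (intro conjI dualC(1,2)[OF C] neg', rule exI[of _ r], rule conjI[OF r(1)],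
          rule exI[of _ r1], rule conjI[OF r1(1)]) (simp only: J T)
  qed
qed

end
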